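(* Let $\mathcal F\in\beta\mathbb N$. If there is a basic class $\mathcal P^u\in\mathcal B$ of the first kind such that $\alpha_{\mathcal F}(\mathcal P^{u+1})>0$ and $\sum_{w\succeq_{\mathcal P}u}\alpha_{\mathcal F}(\mathcal P^w)<\infty$ (i.e. the sum is finite), then $[\mathcal F]$ has an immediate predecessor in the partial order $(\beta\mathbb N/{=_\sim},\widetilde{\mid})$.
   Context: Divisibility of ultrafilters. $\mathbb N=\{1,2,3,\dots\}$, $\mathbb P$ is the set of primes, $\beta\mathbb N$ is the set of ultrafilters on $\mathbb N$, with $n\in\mathbb N$ identified with the principal ultrafilter at $n$. For $A\subseteq\mathbb N$ let $A\uparrow=\{n\in\mathbb N:(\exists a\in A)\,a\mid n\}$, and $\mathcal U=\{A\subseteq\mathbb N: A\ne\emptyset,\ A=A\uparrow\}$. For $\mathcal F,\mathcal G\in\beta\mathbb N$: $\mathcal F\,\widetilde{\mid}\,\mathcal G$ iff $\mathcal F\cap\mathcal U\subseteq\mathcal G$; $\mathcal F=_\sim\mathcal G$ iff $\mathcal F\,\widetilde{\mid}\,\mathcal G$ and $\mathcal G\,\widetilde{\mid}\,\mathcal F$; $[\mathcal F]$ is the $=_\sim$-class of $\mathcal F$, and $\widetilde\mid$ induces a partial order on $\beta\mathbb N/{=_\sim}$. An immediate predecessor of $[\mathcal F]$ is a class $[\mathcal G]\neq[\mathcal F]$ with $\mathcal G\,\widetilde\mid\,\mathcal F$ such that no class lies strictly between $[\mathcal G]$ and $[\mathcal F]$. Nonstandard extension. Standing assumption: we work in a fixed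 nonstandard extension ${}^*$ (of a superstructure over $\mathbb N$) which is $\mathfrak c^+$-saturated and satisfies Henson's isomorphism property (any two elementarily equivalent internally presented structures, for a finite first-order language, are isomorphic). In particular all sets $[1,z]=\{a\in{}^*\mathbb N:a\le z\}$ with $z\in{}^*\mathbb N\setminus\mathbb N$ have the same cardinality, denoted $\infty$. For $x\in{}^*\mathbb N$, $tp(x/\mathbb N)=\{A\subseteq\mathbb N:x\in{}^*A\}\in\beta\mathbb N$; $x\models\mathcal F$ ($x$ is a generator of $\mathcal F$) means $tp(x/\mathbb N)=\mathcal F$. Basic classes. $\overline{\mathbb P}=\{\mathcal P\in\beta\mathbb N:\mathbb P\in\mathcal P\}$. For $\mathcal P\in\overline{\mathbb P}$, on pairs $(p,a)$ with $p\models\mathcal P$, $a\in{}^*\mathbb N$, put $(p,a)\approx_{\mathcal P}(q,b)$ iff $tp(p^a/\mathbb N)=_\sim tp(q^b/\mathbb N)$; $\mathcal E_{\mathcal P}$ is the set of $\approx_{\mathcal P}$-classes. It is linearly ordered by: $u\prec_{\mathcal P}v$ iff $u\ne v$ and for some $p\models\mathcal P$ and $a<b$ in ${}^*\mathbb N$, $(p,a)\in u$ and $(p,b)\in v$; $u\preceq_{\mathcal P}v$ iff $u\prec_{\mathcal P}v$ or $u=v$. For $u\in\mathcal E_{\mathcal P}$ the set $\mathcal P^u=\{tp(p^a/\mathbb N):(p,a)\in u\}$ is called a basic class, and $\mathcal B$ is the set of all basic classes. $p^a\models\mathcal P^u$ means $(p,a)\in u$. For $\mathcal P\in\overline{\mathbb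 P}\setminus\mathbb P$, $\mathcal P^u$ is of the first kind if for every $p\models\mathcal P$ the set $\{a\in{}^*\mathbb N:p^a\models\mathcal P^u\}$ is a singleton; in that case $u$ has an immediate successor in $(\mathcal E_{\mathcal P},\prec_{\mathcal P})$, denoted $u+1$ (if $p^a\models\mathcal P^u$ then $p^{a+1}\models\mathcal P^{u+1}$). Patterns. $\mathbb N_\infty=\{0,1,2,\dots\}\cup\{\infty\}$. For $x\in{}^*\mathbb N$, $p\in{}^*\mathbb P$, $a\in{}^*\mathbb N$, $p^a\,{}^*\!\!\parallel x$ means $x=p^ax'$ with $p$ not dividing $x'$. The pattern of $x$ is $\alpha_x:\mathcal B\to\mathbb N_\infty$, $\alpha_x(\mathcal P^u)=|\{(p,a):p^a\models\mathcal P^u,\ p^a\,{}^*\!\!\parallel x\}|$ (this cardinality is known to lie in $\mathbb N_\infty$). For $\mathcal F\in\beta\mathbb N$, $\alpha_{\mathcal F}:=\alpha_x$ for any $x\models\mathcal F$ (known to be independent of $x$). *)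

theory Defs
  imports
    Complex_Main
    "HOL-Library.Extended_Nat"
    "HOL-Library.Equipollence"
    "HOL-Computational_Algebra.Primes"
begin

section \<open>Divisibility of ultrafilters\<close>

text \<open>The natural numbers of the development start at 1.  Ultrafilters on them are sets of sets.\<close>

definition Npos :: "nat set" where
  "Npos = {n. 0 < n}"

definition primes :: "nat set" where
  "primes = {p. prime p}"

definition betaN :: "nat set set set" where
  "betaN = {F. F \<subseteq> Pow Npos \<and> Npos \<in> F \<and> {} \<notin> F
              \<and> (\<forall>A\<in>F. \<forall>B. A \<subseteq> B \<and> B \<subseteq> Npos \<longrightarrow> B \<in> F)
              \<and> (\<forall>A\<in>F. \<forall>B\<in>F. A \<inter> B \<in> F)
              \<and> (\<forall>A\<subseteq>Npos. A \<in> F \<or> Npos - A \<in> F)}"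

definition principal :: "nat \<Rightarrow> nat set set" where
  "principal n = {A. A \<subseteq> Npos \<and> n \<in> A}"

definition up :: "nat set \<Rightarrow> nat set" where
  "up A = {n \<in> Npos. \<exists>a\<in>A. a dvd n}"

definition upsets :: "nat set set" where
  "upsets = {A. A \<subseteq> Npos \<and> A \<noteq> {} \<and> A = up A}"

definition tdvd :: "nat set set \<Rightarrow> nat set set \<Rightarrow> bool" where
  "tdvd F G \<longleftrightarrow> F \<inter> upsets \<subseteq> G"

definition teq :: "nat set set \<Rightarrow> nat set set \<Rightarrow> bool" where
  "teq F G \<longleftrightarrow> tdvd F G \<and> tdvd G F"

definition teq_rel :: "(nat set set \<times> nat set set) set" where
  "teq_rel = {(F, G). F \<in> betaN \<and> G \<in> betaN \<and> teq F G}"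

definition tclass :: "nat set set \<Rightarrow> nat set set set" where
  "tclass F = teq_rel `` {F}"

definition class_le :: "nat set set set \<Rightarrow> nat set set set \<Rightarrow> bool" where
  "class_le C D \<longleftrightarrow> (\<exists>F\<in>C. \<exists>G\<in>D. tdvd F G)"

definition immediate_predecessor :: "nat set set set \<Rightarrow> nat set set set \<Rightarrow> bool" where
  "immediate_predecessor C D \<longleftrightarrow>
     C \<in> betaN // teq_rel \<and> D \<in> betaN // teq_rel \<and> C \<noteq> D \<and> class_le C D
     \<and> \<not> (\<exists>B \<in> betaN // teq_rel. B \<noteq> C \<and> B \<noteq> D \<and> class_le C B \<and> class_le B D)"


section \<open>Superstructures\<close>

text \<open>
  A type \<open>'v\<close> with a membership relation and a set of atoms is characterised as the
  superstructure over its atoms: the cumulative levels are \<open>V\<^sub>0 = atoms\<close> and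
  \<open>V\<^sub>n\<^sub>+\<^sub>1 = V\<^sub>n \<union> Pow V\<^sub>n\<close>.  The superstructure in the usual sense is the union of all
  \<open>V\<^sub>n\<close>; this is height \<open>\<infinity>\<close>.  Finite heights \<open>h\<close> give the truncation \<open>V\<^sub>h\<close>; they are admitted
  because types are too small in minimal models of HOL to accommodate all finite levels
  over an infinite set at once.
\<close>

record 'v sstr =
  mem :: "'v \<Rightarrow> 'v \<Rightarrow> bool"
  atoms :: "'v set"

definition ext :: "'v sstr \<Rightarrow> 'v \<Rightarrow> 'v set" where
  "ext V y = {x. mem V x y}"

definition is_set :: "'v sstr \<Rightarrow> 'v \<Rightarrow> bool" where
  "is_set V y \<longleftrightarrow> y \<notin> atoms V"

primrec level :: "'v sstr \<Rightarrow> nat \<Rightarrow> 'v set" where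
  "level V 0 = atoms V"
| "level V (Suc n) = level V n \<union> {y. is_set V y \<and> ext V y \<subseteq> level V n}"

definition superstructure :: "enat \<Rightarrow> 'v sstr \<Rightarrow> bool" where
  "superstructure h V \<longleftrightarrow>
     (\<forall>a\<in>atoms V. ext V a = {})
     \<and> (\<forall>x y. is_set V x \<and> is_set V y \<and> ext V x = ext V y \<longrightarrow> x = y)
     \<and> (\<forall>x. \<exists>n. enat n \<le> h \<and> x \<in> level V n)
     \<and> (\<forall>n S. enat (Suc n) \<le> h \<and> S \<subseteq> level V n \<longrightarrow> (\<exists>y. is_set V y \<and> ext V y = S))"

text \<open>Kuratowski pairs and tuples; the 1-tuple of \<open>x\<close> is \<open>x\<close>, the 0-tuple is the empty set.\<close>

definition is_pair :: "'v sstr \<Rightarrow> 'v \<Rightarrow> 'v \<Rightarrow> 'v \<Rightarrow> bool" where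
  "is_pair V z x y \<longleftrightarrow>
     (\<exists>s t. is_set V s \<and> ext V s = {x} \<and> is_set V t \<and> ext V t = {x, y}
            \<and> is_set V z \<and> ext V z = {s, t})"

fun is_tuple :: "'v sstr \<Rightarrow> 'v \<Rightarrow> 'v list \<Rightarrow> bool" where
  "is_tuple V z [] \<longleftrightarrow> is_set V z \<and> ext V z = {}"
| "is_tuple V z [x] \<longleftrightarrow> z = x"
| "is_tuple V z (x # y # ys) \<longleftrightarrow> (\<exists>t. is_tuple V t (y # ys) \<and> is_pair V z x t)"

text \<open>The object \<open>r\<close> of the superstructure is the relation \<open>R\<close>, given as a set of lists.\<close>

definition represents :: "'v sstr \<Rightarrow> 'v \<Rightarrow> 'v list set \<Rightarrow> bool" where
  "represents V r R \<longleftrightarrow>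
     is_set V r \<and> (\<forall>xs\<in>R. \<exists>z. is_tuple V z xs) \<and> ext V r = {z. \<exists>xs\<in>R. is_tuple V z xs}"


section \<open>Nonstandard extensions\<close>

text \<open>Bounded formulas in the language of membership; \<open>BAll i j \<phi>\<close> is \<open>\<forall>v\<^sub>i\<in>v\<^sub>j. \<phi>\<close>.\<close>

datatype bfm =
    BMem nat nat
  | BEq nat nat
  | BNeg bfm
  | BConj bfm bfm
  | BAll nat nat bfm

primrec bsat :: "'v sstr \<Rightarrow> (nat \<Rightarrow> 'v) \<Rightarrow> bfm \<Rightarrow> bool" where
  "bsat V e (BMem i j) \<longleftrightarrow> mem V (e i) (e j)"
| "bsat V e (BEq i j) \<longleftrightarrow> e i = e j"
| "bsat V e (BNeg \<phi>) \<longleftrightarrow> \<not> bsat V e \<phi>"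
| "bsat V e (BConj \<phi> \<psi>) \<longleftrightarrow> bsat V e \<phi> \<and> bsat V e \<psi>"
| "bsat V e (BAll i j \<phi>) \<longleftrightarrow> (\<forall>x. mem V x (e j) \<longrightarrow> bsat V (e(i := x)) \<phi>)"

text \<open>
  \<open>natom X n\<close> is the natural number \<open>n\<close> as an atom of the standard universe.
  The hypernatural numbers are the atoms of the nonstandard universe.
\<close>

record ('v, 'w) nsext =
  stdV :: "'v sstr"
  nstV :: "'w sstr"
  natom :: "nat \<Rightarrow> 'v"
  star :: "'v \<Rightarrow> 'w"

definition nonstandard_extension :: "enat \<Rightarrow> ('v, 'w) nsext \<Rightarrow> bool" where
  "nonstandard_extension h X \<longleftrightarrow>
     superstructure h (stdV X) \<and> superstructure h (nstV X)
     \<and> inj_on (natom X) Npos \<and> atoms (stdV X) = natom X ` Npos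
     \<and> (\<forall>N. is_set (stdV X) N \<and> ext (stdV X) N = atoms (stdV X)
            \<longrightarrow> ext (nstV X) (star X N) = atoms (nstV X))
     \<and> star X ` atoms (stdV X) \<noteq> atoms (nstV X)
     \<and> (\<forall>\<phi> e. bsat (stdV X) e \<phi> \<longleftrightarrow> bsat (nstV X) (star X \<circ> e) \<phi>)"

definition internal_set :: "('v, 'w) nsext \<Rightarrow> 'w \<Rightarrow> bool" where
  "internal_set X y \<longleftrightarrow> is_set (nstV X) y \<and> (\<exists>a. is_set (stdV X) a \<and> mem (nstV X) y (star X a))"

text \<open>\<open>\<cc>\<^sup>+\<close>-saturation: families of fewer than \<open>\<cc>\<^sup>+\<close>, that is at most \<open>\<cc>\<close>, internal sets.\<close>

definition c_plus_saturated :: "('v, 'w) nsext \<Rightarrow> bool" where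
  "c_plus_saturated X \<longleftrightarrow>
     (\<forall>\<A>. (\<forall>a\<in>\<A>. internal_set X a) \<and> \<A> \<lesssim> (UNIV :: real set)
         \<and> (\<forall>\<B>\<subseteq>\<A>. finite \<B> \<longrightarrow> (\<exists>x. \<forall>b\<in>\<B>. mem (nstV X) x b))
         \<longrightarrow> (\<exists>x. \<forall>a\<in>\<A>. mem (nstV X) x a))"


section \<open>The isomorphism property\<close>

datatype fo_tm = FVar nat | FApp nat "fo_tm list"

datatype fo_fm =
    FEq fo_tm fo_tm
  | FRel nat "fo_tm list"
  | FNeg fo_fm
  | FConj fo_fm fo_fm
  | FAll nat fo_fm

text \<open>
  A finite language is given by the lists of the arities of its relation symbols and of its
  function symbols (constants are function symbols of arity 0).
\<close>

record fo_lang =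
  rel_ar :: "nat list"
  fun_ar :: "nat list"

record 'w fo_str =
  univ :: "'w set"
  rels :: "nat \<Rightarrow> 'w list set"
  funs :: "nat \<Rightarrow> 'w list \<Rightarrow> 'w"

primrec wf_tm :: "fo_lang \<Rightarrow> fo_tm \<Rightarrow> bool" where
  "wf_tm L (FVar n) \<longleftrightarrow> True"
| "wf_tm L (FApp f ts) \<longleftrightarrow>
     f < length (fun_ar L) \<and> length ts = fun_ar L ! f \<and> list_all (wf_tm L) ts"

primrec wf_fm :: "fo_lang \<Rightarrow> fo_fm \<Rightarrow> bool" where
  "wf_fm L (FEq s t) \<longleftrightarrow> wf_tm L s \<and> wf_tm L t"
| "wf_fm L (FRel r ts) \<longleftrightarrow>
     r < length (rel_ar L) \<and> length ts = rel_ar L ! r \<and> list_all (wf_tm L) ts"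
| "wf_fm L (FNeg \<phi>) \<longleftrightarrow> wf_fm L \<phi>"
| "wf_fm L (FConj \<phi> \<psi>) \<longleftrightarrow> wf_fm L \<phi> \<and> wf_fm L \<psi>"
| "wf_fm L (FAll n \<phi>) \<longleftrightarrow> wf_fm L \<phi>"

primrec fv_tm :: "fo_tm \<Rightarrow> nat set" where
  "fv_tm (FVar n) = {n}"
| "fv_tm (FApp f ts) = \<Union> (set (map fv_tm ts))"

primrec fv_fm :: "fo_fm \<Rightarrow> nat set" where
  "fv_fm (FEq s t) = fv_tm s \<union> fv_tm t"
| "fv_fm (FRel r ts) = \<Union> (set (map fv_tm ts))"
| "fv_fm (FNeg \<phi>) = fv_fm \<phi>"
| "fv_fm (FConj \<phi> \<psi>) = fv_fm \<phi> \<union> fv_fm \<psi>"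
| "fv_fm (FAll n \<phi>) = fv_fm \<phi> - {n}"

primrec tm_val :: "'w fo_str \<Rightarrow> (nat \<Rightarrow> 'w) \<Rightarrow> fo_tm \<Rightarrow> 'w" where
  "tm_val M e (FVar n) = e n"
| "tm_val M e (FApp f ts) = funs M f (map (tm_val M e) ts)"

primrec fo_sat :: "'w fo_str \<Rightarrow> (nat \<Rightarrow> 'w) \<Rightarrow> fo_fm \<Rightarrow> bool" where
  "fo_sat M e (FEq s t) \<longleftrightarrow> tm_val M e s = tm_val M e t"
| "fo_sat M e (FRel r ts) \<longleftrightarrow> map (tm_val M e) ts \<in> rels M r"
| "fo_sat M e (FNeg \<phi>) \<longleftrightarrow> \<not> fo_sat M e \<phi>"
| "fo_sat M e (FConj \<phi> \<psi>) \<longleftrightarrow> fo_sat M e \<phi> \<and> fo_sat M e \<psi>"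
| "fo_sat M e (FAll n \<phi>) \<longleftrightarrow> (\<forall>x\<in>univ M. fo_sat M (e(n := x)) \<phi>)"

definition tuples :: "'w set \<Rightarrow> nat \<Rightarrow> 'w list set" where
  "tuples D k = {xs. set xs \<subseteq> D \<and> length xs = k}"

definition is_structure :: "fo_lang \<Rightarrow> 'w fo_str \<Rightarrow> bool" where
  "is_structure L M \<longleftrightarrow>
     univ M \<noteq> {}
     \<and> (\<forall>i<length (rel_ar L). rels M i \<subseteq> tuples (univ M) (rel_ar L ! i))
     \<and> (\<forall>i<length (fun_ar L). \<forall>xs\<in>tuples (univ M) (fun_ar L ! i). funs M i xs \<in> univ M)"

definition elem_equiv :: "fo_lang \<Rightarrow> 'w fo_str \<Rightarrow> 'w fo_str \<Rightarrow> bool" where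
  "elem_equiv L M M' \<longleftrightarrow>
     (\<forall>\<phi>. wf_fm L \<phi> \<and> fv_fm \<phi> = {} \<longrightarrow>
        ((\<forall>e. fo_sat M e \<phi>) \<longleftrightarrow> (\<forall>e. fo_sat M' e \<phi>)))"

definition isomorphic :: "fo_lang \<Rightarrow> 'w fo_str \<Rightarrow> 'w fo_str \<Rightarrow> bool" where
  "isomorphic L M M' \<longleftrightarrow>
     (\<exists>g. bij_betw g (univ M) (univ M')
        \<and> (\<forall>i<length (rel_ar L). \<forall>xs\<in>tuples (univ M) (rel_ar L ! i).
              xs \<in> rels M i \<longleftrightarrow> map g xs \<in> rels M' i)
        \<and> (\<forall>i<length (fun_ar L). \<forall>xs\<in>tuples (univ M) (fun_ar L ! i).
              g (funs M i xs) = funs M' i (map g xs)))"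

text \<open>The universe, each relation and the graph of each function are internal.\<close>

definition internally_presented :: "('v, 'w) nsext \<Rightarrow> fo_lang \<Rightarrow> 'w fo_str \<Rightarrow> bool" where
  "internally_presented X L M \<longleftrightarrow>
     is_structure L M
     \<and> (\<exists>d. internal_set X d \<and> ext (nstV X) d = univ M)
     \<and> (\<forall>i<length (rel_ar L). \<exists>r. internal_set X r \<and> represents (nstV X) r (rels M i))
     \<and> (\<forall>i<length (fun_ar L). \<exists>r. internal_set X r \<and>
           represents (nstV X) r {xs @ [funs M i xs] | xs. xs \<in> tuples (univ M) (fun_ar L ! i)})"

definition isomorphism_property :: "('v, 'w) nsext \<Rightarrow> bool" where
  "isomorphism_property X \<longleftrightarrow>
     (\<forall>L M M'. internally_presented X L M \<and> internally_presented X L M' \<and> elem_equiv L M M'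
        \<longrightarrow> isomorphic L M M')"


section \<open>Hypernatural numbers\<close>

abbreviation hnat :: "('v, 'w) nsext \<Rightarrow> 'w set" where
  "hnat X \<equiv> atoms (nstV X)"

text \<open>\<open>star_rel X R xs\<close>: the tuple \<open>xs\<close> belongs to the extension of the relation \<open>R\<close> on numbers.\<close>

definition star_rel :: "('v, 'w) nsext \<Rightarrow> nat list set \<Rightarrow> 'w list \<Rightarrow> bool" where
  "star_rel X R xs \<longleftrightarrow>
     (\<exists>r z. represents (stdV X) r (map (natom X) ` R)
            \<and> is_tuple (nstV X) z xs \<and> mem (nstV X) z (star X r))"

definition hin :: "('v, 'w) nsext \<Rightarrow> 'w \<Rightarrow> nat set \<Rightarrow> bool" where
  "hin X x A \<longleftrightarrow> star_rel X {[n] | n. n \<in> A} [x]"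

definition hless :: "('v, 'w) nsext \<Rightarrow> 'w \<Rightarrow> 'w \<Rightarrow> bool" where
  "hless X x y \<longleftrightarrow> star_rel X {[m, n] | m n. m \<in> Npos \<and> n \<in> Npos \<and> m < n} [x, y]"

definition hdvd :: "('v, 'w) nsext \<Rightarrow> 'w \<Rightarrow> 'w \<Rightarrow> bool" where
  "hdvd X x y \<longleftrightarrow> star_rel X {[m, n] | m n. m \<in> Npos \<and> n \<in> Npos \<and> m dvd n} [x, y]"

definition hmult :: "('v, 'w) nsext \<Rightarrow> 'w \<Rightarrow> 'w \<Rightarrow> 'w" where
  "hmult X x y = (THE z. star_rel X {[m, n, m * n] | m n. m \<in> Npos \<and> n \<in> Npos} [x, y, z])"

definition hpow :: "('v, 'w) nsext \<Rightarrow> 'w \<Rightarrow> 'w \<Rightarrow> 'w" where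
  "hpow X x y = (THE z. star_rel X {[m, n, m ^ n] | m n. m \<in> Npos \<and> n \<in> Npos} [x, y, z])"

definition tp :: "('v, 'w) nsext \<Rightarrow> 'w \<Rightarrow> nat set set" where
  "tp X x = {A. A \<subseteq> Npos \<and> hin X x A}"

definition generator :: "('v, 'w) nsext \<Rightarrow> 'w \<Rightarrow> nat set set \<Rightarrow> bool" where
  "generator X x F \<longleftrightarrow> x \<in> hnat X \<and> tp X x = F"


section \<open>Basic classes\<close>

definition prime_ufs :: "nat set set set" where
  "prime_ufs = {P \<in> betaN. primes \<in> P}"

definition pairs :: "('v, 'w) nsext \<Rightarrow> nat set set \<Rightarrow> ('w \<times> 'w) set" where
  "pairs X P = {(p, a). generator X p P \<and> a \<in> hnat X}"

definition pair_equiv :: "('v, 'w) nsext \<Rightarrow> nat set set \<Rightarrow> (('w \<times> 'w) \<times> ('w \<times> 'w)) set" where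
  "pair_equiv X P = {((p, a), (q, b)). (p, a) \<in> pairs X P \<and> (q, b) \<in> pairs X P
                        \<and> teq (tp X (hpow X p a)) (tp X (hpow X q b))}"

definition exps :: "('v, 'w) nsext \<Rightarrow> nat set set \<Rightarrow> ('w \<times> 'w) set set" where
  "exps X P = pairs X P // pair_equiv X P"

definition exp_less ::
    "('v, 'w) nsext \<Rightarrow> nat set set \<Rightarrow> ('w \<times> 'w) set \<Rightarrow> ('w \<times> 'w) set \<Rightarrow> bool" where
  "exp_less X P u v \<longleftrightarrow> u \<noteq> v \<and>
     (\<exists>p a b. generator X p P \<and> a \<in> hnat X \<and> b \<in> hnat X \<and> hless X a b \<and> (p, a) \<in> u \<and> (p, b) \<in> v)"

definition exp_le ::
    "('v, 'w) nsext \<Rightarrow> nat set set \<Rightarrow> ('w \<times> 'w) set \<Rightarrow> ('w \<times> 'w) set \<Rightarrow> bool" where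
  "exp_le X P u v \<longleftrightarrow> exp_less X P u v \<or> u = v"

text \<open>The immediate successor of \<open>u\<close> in the linear order of exponents.\<close>

definition exp_succ ::
    "('v, 'w) nsext \<Rightarrow> nat set set \<Rightarrow> ('w \<times> 'w) set \<Rightarrow> ('w \<times> 'w) set" where
  "exp_succ X P u = (THE v. v \<in> exps X P \<and> exp_less X P u v
                        \<and> (\<forall>w\<in>exps X P. exp_less X P u w \<longrightarrow> exp_le X P v w))"

text \<open>The basic class \<open>P\<^sup>u\<close>; an element \<open>u\<close> of \<open>exps X P\<close> determines \<open>P\<close>.\<close>

definition basic_class :: "('v, 'w) nsext \<Rightarrow> ('w \<times> 'w) set \<Rightarrow> nat set set set" where
  "basic_class X u = {tp X (hpow X p a) | p a. (p, a) \<in> u}"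

definition first_kind :: "('v, 'w) nsext \<Rightarrow> nat set set \<Rightarrow> ('w \<times> 'w) set \<Rightarrow> bool" where
  "first_kind X P u \<longleftrightarrow>
     P \<in> prime_ufs - principal ` primes \<and> u \<in> exps X P
     \<and> (\<forall>p. generator X p P \<longrightarrow> (\<exists>!a. a \<in> hnat X \<and> (p, a) \<in> u))"


section \<open>Patterns\<close>

text \<open>\<open>p\<^sup>a\<close> generates the basic class \<open>B\<close>.\<close>

definition generates_basic ::
    "('v, 'w) nsext \<Rightarrow> 'w \<Rightarrow> 'w \<Rightarrow> nat set set set \<Rightarrow> bool" where
  "generates_basic X p a B \<longleftrightarrow>
     (\<exists>P\<in>prime_ufs. \<exists>u\<in>exps X P. B = basic_class X u \<and> (p, a) \<in> u)"

definition exact_dvd :: "('v, 'w) nsext \<Rightarrow> 'w \<Rightarrow> 'w \<Rightarrow> 'w \<Rightarrow> bool" where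
  "exact_dvd X p a x \<longleftrightarrow>
     hin X p primes \<and> a \<in> hnat X
     \<and> (\<exists>x'\<in>hnat X. x = hmult X (hpow X p a) x' \<and> \<not> hdvd X p x')"

text \<open>
  All infinite cardinalities which occur in a pattern are equal; hence they can be
  represented by the single infinite element of \<^typ>\<open>enat\<close>.
\<close>

definition ecard :: "'a set \<Rightarrow> enat" where
  "ecard S = (if finite S then enat (card S) else \<infinity>)"

definition pattern :: "('v, 'w) nsext \<Rightarrow> 'w \<Rightarrow> nat set set set \<Rightarrow> enat" where
  "pattern X x B = ecard {(p, a). generates_basic X p a B \<and> exact_dvd X p a x}"

definition uf_pattern :: "('v, 'w) nsext \<Rightarrow> nat set set \<Rightarrow> nat set set set \<Rightarrow> enat" where
  "uf_pattern X F = pattern X (SOME x. generator X x F)"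

text \<open>Unordered sum of a possibly infinite family in \<^typ>\<open>enat\<close>.\<close>

definition esum :: "('a \<Rightarrow> enat) \<Rightarrow> 'a set \<Rightarrow> enat" where
  "esum f W = (SUP S \<in> {S. finite S \<and> S \<subseteq> W}. sum f S)"

end

(* Let x be a generator of F.  Since u is of the first kind, saturation yields a standard function
   f such that f(p) is the exponent of u at every generator p of P, and then f(p) + 1 is the
   exponent of u + 1.  Finiteness of the sum and saturation again give Q in P and k such that
   exactly k primes q of the extension of Q satisfy q^f(q) | x, and for one of them, say the j-th
   in increasing order, the exponent in x is f + 1.  So for F-almost all n, exactly k primes q of Q
   satisfy q^f(q) | n, and the j-th of them, r(n), has exponent f(r(n)) + 1 in n.

   The ultrafilter G generated by the numbers n / r(n) is an immediate predecessor.  If H lies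
   between G and F, then H also concentrates on the numbers with exactly k such primes; r is
   constant along divisibility there.  If the exponent of r(n) is f(r(n)) for H-almost all n, then
   H divides G; otherwise it is f(r(n)) + 1 and F divides H. *)

theory Submission
  imports Defs "HOL-Analysis.Abstract_Topology_2"
begin

section \<open>Ultrafilters\<close>

text \<open>Dividing n by a prime q of exponent f(q) + 1 leaves q with exponent f(q), so q is still
  counted and k does not change; from exponent f(q) the count would drop. This is the role of u + 1.
  Among numbers with exactly k counted primes, a divisor counts a subset of the primes of its
  multiple, of the same finite size, hence the same set. No standard set need isolate the generators
  of P, and a set Q in P may admit other primes. What the sum bounds is the number of true
  generators: each q with q^f(q) | x divides x to an exact power whose class is at least u. If every
  Q counted more primes than this bound, saturation would yield too many generators; so some Q has a
  bounded count, and the extremal value gives k. Transfer is used for a few bounded formulas only.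
  After that, finitely many hypernaturals are written as values of standard functions at one
  hypernatural c, and a relation between them becomes a relation that holds almost everywhere for
  the type of c.\<close>

definition uae :: "nat set set \<Rightarrow> (nat \<Rightarrow> bool) \<Rightarrow> bool" where
  "uae F \<Phi> \<longleftrightarrow> {n \<in> Npos. \<Phi> n} \<in> F"

lemma betaN_superset: "F \<in> betaN \<Longrightarrow> A \<in> F \<Longrightarrow> A \<subseteq> B \<Longrightarrow> B \<subseteq> Npos \<Longrightarrow> B \<in> F"
  by (simp add: betaN_def)

lemma betaN_Int: "F \<in> betaN \<Longrightarrow> A \<in> F \<Longrightarrow> B \<in> F \<Longrightarrow> A \<inter> B \<in> F"
  by (simp add: betaN_def)

lemma betaN_ultra: "F \<in> betaN \<Longrightarrow> A \<subseteq> Npos \<Longrightarrow> A \<in> F \<or> Npos - A \<in> F"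
  by (simp add: betaN_def)

lemma uae_True: "F \<in> betaN \<Longrightarrow> uae F (\<lambda>n. True)"
  by (simp add: uae_def betaN_def)

lemma uae_False: "F \<in> betaN \<Longrightarrow> \<not> uae F (\<lambda>n. False)"
  by (simp add: uae_def betaN_def)

lemma uae_mono:
  assumes "F \<in> betaN" "uae F \<Phi>" "\<And>n. 0 < n \<Longrightarrow> \<Phi> n \<Longrightarrow> \<Psi> n"
  shows "uae F \<Psi>"
proof -
  have "{n \<in> Npos. \<Phi> n} \<subseteq> {n \<in> Npos. \<Psi> n}" using assms(3) by (auto simp: Npos_def)
  moreover have "{n \<in> Npos. \<Psi> n} \<subseteq> Npos" by auto
  ultimately show ?thesis using betaN_superset[OF assms(1)] assms(2) unfolding uae_def by blast
qed

lemma uae_conj: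
  assumes "F \<in> betaN"
  shows "uae F (\<lambda>n. \<Phi> n \<and> \<Psi> n) \<longleftrightarrow> uae F \<Phi> \<and> uae F \<Psi>"
proof
  assume "uae F \<Phi> \<and> uae F \<Psi>"
  then have "{n \<in> Npos. \<Phi> n} \<inter> {n \<in> Npos. \<Psi> n} \<in> F"
    using betaN_Int[OF assms] by (simp only: uae_def)
  moreover have "{n \<in> Npos. \<Phi> n} \<inter> {n \<in> Npos. \<Psi> n} = {n \<in> Npos. \<Phi> n \<and> \<Psi> n}" by blast
  ultimately show "uae F (\<lambda>n. \<Phi> n \<and> \<Psi> n)" unfolding uae_def by simp
next
  assume *: "uae F (\<lambda>n. \<Phi> n \<and> \<Psi> n)"
  show "uae F \<Phi> \<and> uae F \<Psi>"
    by (intro conjI; rule uae_mono[OF assms *]) simp_all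
qed

lemma uae_conjI: "F \<in> betaN \<Longrightarrow> uae F \<Phi> \<Longrightarrow> uae F \<Psi> \<Longrightarrow> uae F (\<lambda>n. \<Phi> n \<and> \<Psi> n)"
  by (simp add: uae_conj)

lemma uae_not:
  assumes "F \<in> betaN"
  shows "uae F (\<lambda>n. \<not> \<Phi> n) \<longleftrightarrow> \<not> uae F \<Phi>"
proof
  assume *: "uae F (\<lambda>n. \<not> \<Phi> n)"
  show "\<not> uae F \<Phi>"
  proof
    assume "uae F \<Phi>"
    from uae_conjI[OF assms this *] have "uae F (\<lambda>n. False)" by (simp only: simp_thms)
    with uae_False[OF assms] show False ..
  qed
next
  assume "\<not> uae F \<Phi>"
  moreover have "{n \<in> Npos. \<Phi> n} \<in> F \<or> Npos - {n \<in> Npos. \<Phi> n} \<in> F"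
    by (rule betaN_ultra[OF assms]) auto
  moreover have "Npos - {n \<in> Npos. \<Phi> n} = {n \<in> Npos. \<not> \<Phi> n}" by blast
  ultimately show "uae F (\<lambda>n. \<not> \<Phi> n)" by (simp only: uae_def simp_thms)
qed

lemma uae_disj:
  assumes "F \<in> betaN"
  shows "uae F (\<lambda>n. \<Phi> n \<or> \<Psi> n) \<longleftrightarrow> uae F \<Phi> \<or> uae F \<Psi>"
  using uae_not[OF assms, of "\<lambda>n. \<not> \<Phi> n \<and> \<not> \<Psi> n"] uae_conj[OF assms, of "\<lambda>n. \<not> \<Phi> n" "\<lambda>n. \<not> \<Psi> n"]
    uae_not[OF assms, of \<Phi>] uae_not[OF assms, of \<Psi>] by simp

text \<open>An ultrafilter that contains a finite union contains one of its parts. The bound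
  \<open>k\<close> is the same for all \<open>n\<close>; this later fixes the position of a prime
  that a priori varies with \<open>n\<close>.\<close>

lemma uae_ex_less:
  assumes "F \<in> betaN" "uae F (\<lambda>n. \<exists>i<k::nat. \<Phi> i n)"
  shows "\<exists>i<k. uae F (\<Phi> i)"
  using assms(2)
proof (induction k)
  case 0
  then show ?case using assms(1) by (simp add: uae_def betaN_def)
next
  case (Suc k)
  have "uae F (\<lambda>n. (\<exists>i<k. \<Phi> i n) \<or> \<Phi> k n)"
    by (rule uae_mono[OF assms(1) Suc.prems]) (auto simp: less_Suc_eq)
  then have "uae F (\<lambda>n. \<exists>i<k. \<Phi> i n) \<or> uae F (\<Phi> k)"
    by (simp only: uae_disj[OF assms(1)])
  then show ?case
  proof
    assume "uae F (\<lambda>n. \<exists>i<k. \<Phi> i n)"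
    then obtain i where "i < k" "uae F (\<Phi> i)" using Suc.IH by auto
    then show ?thesis by (intro exI[of _ i]) simp
  next
    assume "uae F (\<Phi> k)"
    then show ?thesis by (intro exI[of _ k]) simp
  qed
qed

lemma uae_all: "F \<in> betaN \<Longrightarrow> (\<And>n. 0 < n \<Longrightarrow> \<Phi> n) \<Longrightarrow> uae F \<Phi>"
  by (rule uae_mono[OF _ uae_True])

lemma uae_mem: "F \<in> betaN \<Longrightarrow> A \<subseteq> Npos \<Longrightarrow> A \<in> F \<longleftrightarrow> uae F (\<lambda>n. n \<in> A)"
proof -
  assume "A \<subseteq> Npos"
  then have "{n \<in> Npos. n \<in> A} = A" by auto
  then show ?thesis by (simp add: uae_def)
qed

text \<open>One inclusion is enough because ultrafilters are maximal: a property that fails for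
  \<open>F\<close> has its negation in \<open>F\<close>, and the negation passes to
  \<open>G\<close>.\<close>

lemma betaN_eqI:
  assumes "F \<in> betaN" "G \<in> betaN" "\<And>\<Phi>. uae F \<Phi> \<Longrightarrow> uae G \<Phi>"
  shows "F = G"
proof -
  have "uae F \<Phi> \<longleftrightarrow> uae G \<Phi>" for \<Phi>
    using assms(3) uae_not[OF assms(1), of \<Phi>] uae_not[OF assms(2), of \<Phi>] by blast
  moreover have "F \<subseteq> Pow Npos" "G \<subseteq> Pow Npos" using assms(1,2) unfolding betaN_def by auto
  ultimately have "A \<in> F \<longleftrightarrow> A \<in> G" for A
    using uae_mem[OF assms(1), of A] uae_mem[OF assms(2), of A] by (cases "A \<subseteq> Npos") auto
  then show ?thesis by blast
qed

text \<open>The multiples of the numbers with property \<open>\<Phi>\<close> form the least upset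
  that contains these numbers, so testing all upsets is the same as testing these closures. The gain
  is that an arbitrary \<open>\<Phi>\<close>, not only an upward closed one, can be carried along to
  a divisor.\<close>

lemma tdvd_iff:
  assumes "F \<in> betaN" "G \<in> betaN"
  shows "tdvd F G \<longleftrightarrow> (\<forall>\<Phi>. uae F \<Phi> \<longrightarrow> uae G (\<lambda>n. \<exists>m>0. m dvd n \<and> \<Phi> m))" (is "_ = ?R")
proof
  assume d: "tdvd F G"
  show ?R
  proof (intro allI impI)
    fix \<Phi> assume \<Phi>: "uae F \<Phi>"
    define A where "A = {n \<in> Npos. \<exists>m>0. m dvd n \<and> \<Phi> m}"
    have "uae F (\<lambda>n. \<exists>m>0. m dvd n \<and> \<Phi> m)" using \<Phi> by (rule uae_mono[OF assms(1)]) auto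
    then have "A \<in> F" by (simp add: uae_def A_def)
    moreover have "A = up A" unfolding up_def A_def by (auto intro: dvd_trans)
    moreover have "A \<noteq> {}" using \<open>A \<in> F\<close> assms(1) by (auto simp: betaN_def)
    ultimately have "A \<in> G" using d unfolding tdvd_def upsets_def A_def by blast
    then show "uae G (\<lambda>n. \<exists>m>0. m dvd n \<and> \<Phi> m)" by (simp add: uae_def A_def)
  qed
next
  assume r: ?R
  show "tdvd F G" unfolding tdvd_def
  proof
    fix A assume "A \<in> F \<inter> upsets"
    then have A: "A \<in> F" "A \<subseteq> Npos" "A = up A" by (auto simp: upsets_def)
    then have "uae F (\<lambda>n. n \<in> A)" using uae_mem[OF assms(1)] by blast
    then have "uae G (\<lambda>n. \<exists>m>0. m dvd n \<and> m \<in> A)" using r by blast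
    then have "uae G (\<lambda>n. n \<in> A)"
      by (rule uae_mono[OF assms(2)]) (subst A(3), auto simp: up_def Npos_def)
    then show "A \<in> G" using uae_mem[OF assms(2)] A by blast
  qed
qed

lemma tdvdD:
  "F \<in> betaN \<Longrightarrow> G \<in> betaN \<Longrightarrow> tdvd F G \<Longrightarrow> uae F \<Phi> \<Longrightarrow> uae G (\<lambda>n. \<exists>m>0. m dvd n \<and> \<Phi> m)"
  by (simp add: tdvd_iff)

lemma tdvd_upward:
  assumes "F \<in> betaN" "G \<in> betaN" "tdvd F G" "uae F \<Phi>"
    and "\<And>m n. 0 < n \<Longrightarrow> m dvd n \<Longrightarrow> \<Phi> m \<Longrightarrow> \<Phi> n"
  shows "uae G \<Phi>"
  using tdvdD[OF assms(1-4)] by (rule uae_mono[OF assms(2)]) (use assms(5) in blast)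

lemma tdvdI_upward:
  assumes "F \<in> betaN" "G \<in> betaN"
    and "\<And>\<Phi>. uae F \<Phi> \<Longrightarrow> (\<And>m n. 0 < n \<Longrightarrow> m dvd n \<Longrightarrow> \<Phi> m \<Longrightarrow> \<Phi> n) \<Longrightarrow> uae G \<Phi>"
  shows "tdvd F G"
  unfolding tdvd_iff[OF assms(1,2)]
proof (intro allI impI assms(3))
  fix \<Phi> assume "uae F \<Phi>"
  then show "uae F (\<lambda>n. \<exists>m>0. m dvd n \<and> \<Phi> m)" by (rule uae_mono[OF assms(1)]) auto
qed (auto intro: dvd_trans)

lemma tdvd_refl: "tdvd F F" and tdvd_trans: "tdvd F G \<Longrightarrow> tdvd G H \<Longrightarrow> tdvd F H"
  unfolding tdvd_def by blast+

lemma equiv_teq_rel: "equiv betaN teq_rel"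
  unfolding equiv_def refl_on_def sym_def trans_def teq_rel_def teq_def
  using tdvd_refl tdvd_trans by blast

lemma tclass_eq_iff:
  assumes "F \<in> betaN" "G \<in> betaN"
  shows "tclass F = tclass G \<longleftrightarrow> teq F G"
  unfolding tclass_def using eq_equiv_class_iff[OF equiv_teq_rel assms] assms
  by (simp add: teq_rel_def)

lemma tclass_in_quotient: "F \<in> betaN \<Longrightarrow> tclass F \<in> betaN // teq_rel"
  unfolding tclass_def by (rule quotientI)

lemma class_le_iff:
  assumes "F \<in> betaN" "G \<in> betaN"
  shows "class_le (tclass F) (tclass G) \<longleftrightarrow> tdvd F G"
  using assms tdvd_refl tdvd_trans unfolding class_le_def tclass_def teq_rel_def teq_def by blast

text \<open>Every class is \<open>tclass H\<close> for some \<open>H\<close>, and the order does not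
  depend on the representative, so the quotient can be eliminated. Given that \<open>H\<close> lies
  between \<open>G\<close> and \<open>F\<close>, being equivalent to an end point needs only the one
  missing direction.\<close>

lemma immediate_predecessor_iff:
  assumes "F \<in> betaN" "G \<in> betaN"
  shows "immediate_predecessor (tclass G) (tclass F) \<longleftrightarrow>
    tdvd G F \<and> \<not> tdvd F G \<and> (\<forall>H\<in>betaN. tdvd G H \<longrightarrow> tdvd H F \<longrightarrow> tdvd H G \<or> tdvd F H)"
proof -
  have cls: "tclass H = tclass K \<longleftrightarrow> teq H K" "class_le (tclass H) (tclass K) \<longleftrightarrow> tdvd H K"
    if "H \<in> betaN" "K \<in> betaN" for H K
    using that by (rule tclass_eq_iff, rule class_le_iff)
  have q: "B \<in> betaN // teq_rel \<longleftrightarrow> (\<exists>H\<in>betaN. B = tclass H)" for B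
    by (auto simp: quotient_def tclass_def)
  have "(\<exists>B \<in> betaN // teq_rel. \<Psi> B) \<longleftrightarrow> (\<exists>H\<in>betaN. \<Psi> (tclass H))" for \<Psi>
    unfolding Bex_def q by blast
  then have "(\<exists>B \<in> betaN // teq_rel. B \<noteq> tclass G \<and> B \<noteq> tclass F \<and> class_le (tclass G) B \<and> class_le B (tclass F))
    \<longleftrightarrow> (\<exists>H\<in>betaN. tclass H \<noteq> tclass G \<and> tclass H \<noteq> tclass F \<and> class_le (tclass G) (tclass H) \<and> class_le (tclass H) (tclass F))" .
  also have "\<dots> \<longleftrightarrow> (\<exists>H\<in>betaN. \<not> teq H G \<and> \<not> teq H F \<and> tdvd G H \<and> tdvd H F)"
    by (intro bex_cong refl) (simp add: cls assms)
  finally show ?thesis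
    unfolding immediate_predecessor_def
    by (simp add: tclass_in_quotient assms cls teq_def) blast
qed

section \<open>A criterion for an immediate predecessor\<close>

text \<open>\<open>U\<close> and \<open>V\<close> are upward closed, so an ultrafilter between \<open>F\<close> and its predecessor
  concentrates on the convex set \<open>U - V\<close>, on which \<open>r\<close> is constant along divisibility.\<close>

lemma ex_immediate_predecessor:
  fixes r f :: "nat \<Rightarrow> nat"
  assumes F: "F \<in> betaN"
    and U: "\<And>m n. 0 < n \<Longrightarrow> m dvd n \<Longrightarrow> U m \<Longrightarrow> U n"
    and V: "\<And>m n. 0 < n \<Longrightarrow> m dvd n \<Longrightarrow> V m \<Longrightarrow> V n"
    and prime: "\<And>n. 0 < n \<Longrightarrow> U n \<Longrightarrow> \<not> V n \<Longrightarrow> prime (r n)"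
    and const: "\<And>m n. 0 < n \<Longrightarrow> m dvd n \<Longrightarrow> U m \<Longrightarrow> \<not> V n \<Longrightarrow> r m = r n"
    and pred: "\<And>n. 0 < n \<Longrightarrow> U n \<Longrightarrow> \<not> V n \<Longrightarrow>
      multiplicity (r n) n = Suc (f (r n)) \<Longrightarrow> U (n div r n)"
    and large: "uae F (\<lambda>n. U n \<and> \<not> V n \<and> multiplicity (r n) n = Suc (f (r n)))"
  shows "\<exists>C. immediate_predecessor C (tclass F)"
proof -
  define e where "e n = multiplicity (r n) n" for n
  note pred = pred[folded e_def] and large = large[folded e_def]
  define D where "D n \<longleftrightarrow> 0 < n \<and> U n \<and> \<not> V n" for n
  define S where "S n \<longleftrightarrow> D n \<and> e n = Suc (f (r n))" for n
  define t where "t n = n div r n" for n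
  have S: "uae F S" using large by (rule uae_mono[OF F]) (auto simp: S_def D_def)
  have Dd: "D n" if "D m" "D l" "m dvd n" "n dvd l" "0 < n" for m n l
    using that U V unfolding D_def by blast
  have t: "0 < t n" "t n * r n = n" "D (t n)" "r (t n) = r n" "t n dvd n" "e (t n) = f (r n)" if "S n" for n
  proof -
    have n: "D n" "e n = Suc (f (r n))" "0 < n" using that by (auto simp: S_def D_def)
    have p: "prime (r n)" using n(1) prime by (auto simp: D_def)
    have "r n dvd n" using n(2) unfolding e_def by (metis multiplicity_eq_zero_iff not_dvd_imp_multiplicity_0 nat.distinct(1))
    then show t: "t n * r n = n" by (simp add: t_def)
    then show "t n dvd n" by (metis dvd_triv_left)
    show "0 < t n" using t n(3) by (cases "t n") auto
    have u: "U (t n)" using pred n unfolding D_def t_def by blast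
    moreover have "\<not> V (t n)" using V[OF n(3) \<open>t n dvd n\<close>] n(1) by (auto simp: D_def)
    ultimately show "D (t n)" using \<open>0 < t n\<close> by (simp add: D_def)
    show r: "r (t n) = r n" using const[OF n(3) \<open>t n dvd n\<close> u] n(1) by (simp add: D_def)
    have "multiplicity (r n) (t n * r n) = multiplicity (r n) (t n) + 1"
      using p \<open>0 < t n\<close> by (subst prime_elem_multiplicity_mult_distrib) (auto simp: prime_elem_nat_iff)
    then show "e (t n) = f (r n)" using n(2) t by (simp add: e_def r)
  qed
  \<comment> \<open>The image of \<open>F\<close> under \<open>t\<close>. The conjunct
    \<open>S n\<close> is kept inside because only there is \<open>t n\<close> known to be a
    positive number in the convex set.\<close>
  define G where "G = {A. A \<subseteq> Npos \<and> uae F (\<lambda>n. S n \<and> t n \<in> A)}"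
  have uG: "uae G \<Phi> \<longleftrightarrow> uae F (\<lambda>n. S n \<and> \<Phi> (t n))" for \<Phi>
  proof -
    have "(\<lambda>n. S n \<and> t n \<in> {n \<in> Npos. \<Phi> n}) = (\<lambda>n. S n \<and> \<Phi> (t n))" using t(1) by (auto simp: Npos_def)
    moreover have "uae G \<Phi> \<longleftrightarrow> {n \<in> Npos. \<Phi> n} \<in> G" by (simp only: uae_def)
    moreover have "{n \<in> Npos. \<Phi> n} \<subseteq> Npos" by blast
    ultimately show ?thesis by (simp only: G_def mem_Collect_eq simp_thms)
  qed
  have G: "G \<in> betaN" unfolding betaN_def
  proof (intro CollectI conjI ballI allI impI)
    show "G \<subseteq> Pow Npos" "{} \<notin> G" using uae_False[OF F] by (auto simp: G_def)
    have "uae F (\<lambda>n. S n \<and> t n \<in> Npos)"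
      using S by (rule uae_mono[OF F]) (simp add: t(1) Npos_def)
    then show "Npos \<in> G" by (simp add: G_def)
    show "B \<in> G" if "A \<in> G" "A \<subseteq> B \<and> B \<subseteq> Npos" for A B
    proof -
      have "uae F (\<lambda>n. S n \<and> t n \<in> A)" using that by (simp add: G_def)
      then have "uae F (\<lambda>n. S n \<and> t n \<in> B)" by (rule uae_mono[OF F]) (use that in blast)
      then show ?thesis using that by (simp add: G_def)
    qed
    show "A \<inter> B \<in> G" if "A \<in> G" "B \<in> G" for A B
    proof -
      have "uae F (\<lambda>n. (S n \<and> t n \<in> A) \<and> S n \<and> t n \<in> B)"
        using that by (simp add: G_def uae_conj[OF F])
      then have "uae F (\<lambda>n. S n \<and> t n \<in> A \<inter> B)" by (rule uae_mono[OF F]) blast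
      then show ?thesis using that by (auto simp: G_def)
    qed
    show "A \<in> G \<or> Npos - A \<in> G" if "A \<subseteq> Npos" for A
    proof -
      have "uae F (\<lambda>n. (S n \<and> t n \<in> A) \<or> (S n \<and> t n \<in> Npos - A))"
        using S by (rule uae_mono[OF F]) (use t(1) in \<open>auto simp: Npos_def\<close>)
      then show ?thesis using that unfolding uae_disj[OF F] by (auto simp: G_def)
    qed
  qed
  have GF: "tdvd G F"
  proof (rule tdvdI_upward[OF G F])
    fix \<Phi> assume "uae G \<Phi>" and up: "\<And>m n. 0 < n \<Longrightarrow> m dvd n \<Longrightarrow> \<Phi> m \<Longrightarrow> \<Phi> n"
    then have "uae F (\<lambda>n. S n \<and> \<Phi> (t n))" by (simp only: uG)
    then show "uae F \<Phi>" by (rule uae_mono[OF F]) (use up t(5) in blast)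
  qed
  have emono: "e m \<le> e n" if "D m" "D n" "m dvd n" for m n
  proof -
    have "r m = r n" using that const by (auto simp: D_def)
    then show ?thesis using that unfolding e_def by (simp add: dvd_imp_multiplicity_le D_def)
  qed
  \<comment> \<open>The one invariant of the proof, upward closed for each \<open>l\<close>; the
    disjunct \<open>V n\<close> is there because \<open>r\<close> may change once \<open>V\<close>
    is entered. The value \<open>l = 1\<close> separates \<open>F\<close> from \<open>G\<close>,
    \<open>l = 0\<close> is carried from \<open>G\<close> up to \<open>H\<close>, and
    \<open>l = 2\<close> would be carried from \<open>H\<close> up to \<open>F\<close>, where it
    fails.\<close>
  have upw: "V n \<or> (U n \<and> l + f (r n) \<le> e n)" if "0 < n" "m dvd n" "V m \<or> (U m \<and> l + f (r m) \<le> e m)" for m n l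
  proof (cases "V n")
    case False
    then have "D n" "D m" using that U V by (auto simp: D_def)
    then show ?thesis using emono[of m n] const[of n m] that by (auto simp: D_def)
  qed simp
  have "\<not> tdvd F G"
  proof
    assume d: "tdvd F G"
    have "uae F (\<lambda>n. V n \<or> (U n \<and> 1 + f (r n) \<le> e n))"
      using S by (rule uae_mono[OF F]) (auto simp: S_def D_def)
    then have "uae G (\<lambda>n. V n \<or> (U n \<and> 1 + f (r n) \<le> e n))"
      by (rule tdvd_upward[OF F G d]) (rule upw)
    then have "uae F (\<lambda>n. S n \<and> (V (t n) \<or> (U (t n) \<and> 1 + f (r (t n)) \<le> e (t n))))" by (simp add: uG)
    then have "uae F (\<lambda>n. False)" by (rule uae_mono[OF F]) (use t in \<open>auto simp: D_def\<close>)
    then show False using uae_False[OF F] by simp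
  qed
  moreover have "tdvd H G \<or> tdvd F H" if H: "H \<in> betaN" and GH: "tdvd G H" and HF: "tdvd H F" for H
  proof -
    have V0: "uae F (\<lambda>n. \<not> V n)" using S by (rule uae_mono[OF F]) (auto simp: S_def D_def)
    have "uae G (\<lambda>n. V n \<or> (U n \<and> 0 + f (r n) \<le> e n))"
      unfolding uG using S by (rule uae_mono[OF F]) (use t in \<open>auto simp: D_def\<close>)
    then have "uae H (\<lambda>n. V n \<or> (U n \<and> 0 + f (r n) \<le> e n))"
      by (rule tdvd_upward[OF G H GH]) (rule upw)
    moreover have "\<not> uae H V"
    proof
      assume "uae H V"
      then have "uae F V" by (rule tdvd_upward[OF H F HF]) (rule V)
      then show False using V0 uae_not[OF F, of V] by simp
    qed
    moreover have "\<not> uae H (\<lambda>n. V n \<or> (U n \<and> 2 + f (r n) \<le> e n))"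
    proof
      assume "uae H (\<lambda>n. V n \<or> (U n \<and> 2 + f (r n) \<le> e n))"
      then have "uae F (\<lambda>n. V n \<or> (U n \<and> 2 + f (r n) \<le> e n))"
      by (rule tdvd_upward[OF H F HF]) (rule upw)
      then have "uae F (\<lambda>n. S n \<and> (V n \<or> (U n \<and> 2 + f (r n) \<le> e n)))" by (rule uae_conjI[OF F S])
      then have "uae F (\<lambda>n. False)" by (rule uae_mono[OF F]) (auto simp: S_def D_def)
      then show False using uae_False[OF F] by simp
    qed
    \<comment> \<open>At least \<open>f (r n)\<close> and less than \<open>2 + f (r n)\<close>: two
      exponents remain, and the ultrafilter chooses one of them.\<close>
    ultimately have "uae H (\<lambda>n. (V n \<or> (U n \<and> 0 + f (r n) \<le> e n)) \<and> \<not> V n \<and> \<not> (V n \<or> (U n \<and> 2 + f (r n) \<le> e n)))"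
      by (simp only: uae_conj[OF H] uae_not[OF H] simp_thms)
    then have "uae H (\<lambda>n. (D n \<and> e n = f (r n)) \<or> S n)"
      by (rule uae_mono[OF H]) (auto simp: D_def S_def)
    then consider "uae H (\<lambda>n. D n \<and> e n = f (r n))" | "uae H S" unfolding uae_disj[OF H] by (elim disjE)
    then show ?thesis
    proof cases
      case 1
      have "tdvd H G"
      proof (rule tdvdI_upward[OF H G])
        fix \<Phi> assume \<Phi>: "uae H \<Phi>" and up: "\<And>m n. 0 < n \<Longrightarrow> m dvd n \<Longrightarrow> \<Phi> m \<Longrightarrow> \<Phi> n"
        have "uae H (\<lambda>n. \<Phi> n \<and> D n \<and> e n = f (r n))" by (rule uae_conjI[OF H \<Phi> 1])
        then have "uae F (\<lambda>n. \<exists>m>0. m dvd n \<and> \<Phi> m \<and> D m \<and> e m = f (r m))" by (rule tdvdD[OF H F HF])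
        then have "uae F (\<lambda>n. S n \<and> (\<exists>m>0. m dvd n \<and> \<Phi> m \<and> D m \<and> e m = f (r m)))" by (rule uae_conjI[OF F S])
        then show "uae G \<Phi>" unfolding uG
        proof (rule uae_mono[OF F], safe)
          fix n m assume n: "S n" "m dvd n" "\<Phi> m" "D m" "e m = f (r m)"
          have r: "r m = r n" using const[of n m] n by (auto simp: S_def D_def)
          have p: "prime (r n)" using n prime by (auto simp: S_def D_def)
          obtain k where k: "n = m * k" using n by blast
          have pos: "0 < m" "0 < k" using n k by (auto simp: D_def S_def)
          \<comment> \<open>The exponents in \<open>n\<close> and \<open>m\<close> differ by one, so
            the cofactor \<open>k\<close> contains the prime \<open>r n\<close>. Removing it from
            \<open>k\<close> shows that \<open>m\<close> divides \<open>t n\<close>.\<close>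
          have "multiplicity (r n) (m * k) = multiplicity (r n) m + multiplicity (r n) k"
            using p pos by (subst prime_elem_multiplicity_mult_distrib) (auto simp: prime_elem_nat_iff)
          then have "multiplicity (r n) k = 1" using n k r by (auto simp: S_def e_def)
          then have "r n dvd k" by (metis multiplicity_eq_zero_iff not_dvd_imp_multiplicity_0 zero_neq_one)
          then have "m dvd t n" unfolding t_def k using p by (simp add: div_mult_swap[symmetric])
          then show "\<Phi> (t n)" by (rule up[OF t(1)[OF n(1)] _ n(3)])
        qed
      qed
      then show ?thesis ..
    next
      case 2
      have "tdvd F H"
      proof (rule tdvdI_upward[OF F H])
        fix \<Phi> assume \<Phi>: "uae F \<Phi>" and up: "\<And>m n. 0 < n \<Longrightarrow> m dvd n \<Longrightarrow> \<Phi> m \<Longrightarrow> \<Phi> n"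
        have "uae F (\<lambda>n. S n \<and> \<Phi> n)" by (rule uae_conjI[OF F S \<Phi>])
        \<comment> \<open>Since \<open>n\<close> is \<open>t n * r n\<close> and
          \<open>r (t n)\<close> is \<open>r n\<close>, what \<open>F\<close> says about
          \<open>n\<close> is seen by \<open>G\<close> at \<open>t n\<close> as a statement about
          the product with \<open>r\<close>. The same cofactor argument then puts
          \<open>m * r m\<close> below \<open>n\<close>.\<close>
        then have "uae G (\<lambda>n. D n \<and> e n = f (r n) \<and> \<Phi> (n * r n))"
          unfolding uG by (rule uae_mono[OF F]) (use t in auto)
        then have "uae H (\<lambda>n. \<exists>m>0. m dvd n \<and> D m \<and> e m = f (r m) \<and> \<Phi> (m * r m))" by (rule tdvdD[OF G H GH])
        then have "uae H (\<lambda>n. S n \<and> (\<exists>m>0. m dvd n \<and> D m \<and> e m = f (r m) \<and> \<Phi> (m * r m)))" by (rule uae_conjI[OF H 2])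
        then show "uae H \<Phi>"
        proof (rule uae_mono[OF H], safe)
          fix n m assume n: "S n" "m dvd n" "\<Phi> (m * r m)" "D m" "e m = f (r m)"
          have r: "r m = r n" using const[of n m] n by (auto simp: S_def D_def)
          have p: "prime (r n)" using n prime by (auto simp: S_def D_def)
          obtain k where k: "n = m * k" using n by blast
          have pos: "0 < m" "0 < k" "0 < n" using n k by (auto simp: D_def S_def)
          have "multiplicity (r n) (m * k) = multiplicity (r n) m + multiplicity (r n) k"
            using p pos by (subst prime_elem_multiplicity_mult_distrib) (auto simp: prime_elem_nat_iff)
          then have "multiplicity (r n) k = 1" using n k r by (auto simp: S_def e_def)
          then have "r n dvd k" by (metis multiplicity_eq_zero_iff not_dvd_imp_multiplicity_0 zero_neq_one)
          then have "m * r m dvd n" unfolding r k by (rule mult_dvd_mono[OF dvd_refl])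
          then show "\<Phi> n" by (rule up[OF pos(3) _ n(3)])
        qed
      qed
      then show ?thesis ..
    qed
  qed
  ultimately have "immediate_predecessor (tclass G) (tclass F)"
    unfolding immediate_predecessor_iff[OF F G] using GF by (intro conjI ballI impI)
  then show ?thesis by (rule exI)
qed

section \<open>Superstructures and bounded formulas\<close>

lemma level_mono: "m \<le> n \<Longrightarrow> level V m \<subseteq> level V n"
  by (rule lift_Suc_mono_le[of "level V"]) auto

lemma ext_atom: "superstructure h V \<Longrightarrow> a \<in> atoms V \<Longrightarrow> \<not> mem V x a"
  unfolding superstructure_def ext_def by blast

lemma mem_is_set: "superstructure h V \<Longrightarrow> mem V x y \<Longrightarrow> is_set V y"
  using ext_atom[of h V y x] by (auto simp: is_set_def)

lemma set_extensionality:
  "superstructure h V \<Longrightarrow> is_set V x \<Longrightarrow> is_set V y \<Longrightarrow> ext V x = ext V y \<Longrightarrow> x = y"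
  unfolding superstructure_def by blast

lemma ex_set_of_level:
  assumes "superstructure h V" "enat (Suc n) \<le> h" "A \<subseteq> level V n"
  shows "\<exists>y\<in>level V (Suc n). is_set V y \<and> ext V y = A"
proof -
  obtain y where "is_set V y" "ext V y = A" using assms unfolding superstructure_def by blast
  then show ?thesis using assms(3) by auto
qed

text \<open>Here every quantifier is bounded by \<open>z\<close> or by a member of \<open>z\<close>,
  which is what a \<open>bfm\<close> can express. The \<open>is_set\<close> conditions are absorbed,
  since an object with a member is not an atom.\<close>

lemma is_pair_iff_mem:
  assumes "superstructure h V"
  shows "is_pair V z x y \<longleftrightarrow>
    (\<exists>s. mem V s z \<and> (\<exists>t. mem V t z \<and> mem V x s \<and> (\<forall>w. mem V w s \<longrightarrow> w = x) \<and> mem V x t \<and> mem V y t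
      \<and> (\<forall>w. mem V w t \<longrightarrow> w = x \<or> w = y) \<and> (\<forall>w. mem V w z \<longrightarrow> w = s \<or> w = t)))" (is "_ \<longleftrightarrow> ?R")
proof
  assume "is_pair V z x y"
  then obtain s t where st: "ext V s = {x}" "ext V t = {x, y}" "ext V z = {s, t}"
    unfolding is_pair_def by blast
  have "mem V w s \<longleftrightarrow> w = x" "mem V w t \<longleftrightarrow> w = x \<or> w = y" "mem V w z \<longleftrightarrow> w = s \<or> w = t" for w
    using st by (auto simp: ext_def)
  then show ?R by auto
next
  assume ?R
  then obtain s t where st: "mem V s z" "mem V t z" "mem V x s" "\<forall>w. mem V w s \<longrightarrow> w = x" "mem V x t" "mem V y t"
      "\<forall>w. mem V w t \<longrightarrow> w = x \<or> w = y" "\<forall>w. mem V w z \<longrightarrow> w = s \<or> w = t" by blast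
  have "ext V s = {x}" "ext V t = {x, y}" "ext V z = {s, t}" using st unfolding ext_def by blast+
  moreover have "is_set V s" "is_set V t" "is_set V z" using st mem_is_set[OF assms] by blast+
  ultimately show "is_pair V z x y" unfolding is_pair_def by blast
qed

lemma ex_pair:
  assumes V: "superstructure h V" and "enat (n + 2) \<le> h" "x \<in> level V n" "y \<in> level V n"
  shows "\<exists>z\<in>level V (n + 2). is_pair V z x y"
proof -
  have h: "enat (Suc n) \<le> h" using assms(2) by (metis add_2_eq_Suc' enat_ord_simps(1) le_SucI order_refl order_trans)
  obtain s where s: "s \<in> level V (Suc n)" "is_set V s" "ext V s = {x}"
    using ex_set_of_level[OF V h, of "{x}"] assms by blast
  obtain t where t: "t \<in> level V (Suc n)" "is_set V t" "ext V t = {x, y}"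
    using ex_set_of_level[OF V h, of "{x, y}"] assms by blast
  obtain z where "z \<in> level V (Suc (Suc n))" "is_set V z" "ext V z = {s, t}"
    using ex_set_of_level[OF V _, of "Suc n" "{s, t}"] assms s t by auto
  then show ?thesis using s t unfolding is_pair_def by (intro bexI[of _ z]) auto
qed

lemma is_pair_unique:
  assumes V: "superstructure h V" and "is_pair V z x y" "is_pair V z' x y"
  shows "z = z'"
proof -
  obtain s t where 1: "is_set V s" "ext V s = {x}" "is_set V t" "ext V t = {x, y}" "is_set V z" "ext V z = {s, t}"
    using assms(2) unfolding is_pair_def by blast
  obtain s' t' where 2: "is_set V s'" "ext V s' = {x}" "is_set V t'" "ext V t' = {x, y}" "is_set V z'" "ext V z' = {s', t'}"
    using assms(3) unfolding is_pair_def by blast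
  have "s = s'" "t = t'" using set_extensionality[OF V] 1 2 by simp_all
  then show ?thesis using set_extensionality[OF V 1(5) 2(5)] 1 2 by simp
qed

lemma is_pair_inject:
  assumes "is_pair V z x y" "is_pair V z x' y'"
  shows "x = x' \<and> y = y'"
proof -
  obtain s t where "ext V s = {x}" "ext V t = {x, y}" "ext V z = {s, t}"
    using assms(1) unfolding is_pair_def by blast
  then have "ext V ` ext V z = {{x}, {x, y}}" by simp
  moreover obtain s' t' where "ext V s' = {x'}" "ext V t' = {x', y'}" "ext V z = {s', t'}"
    using assms(2) unfolding is_pair_def by blast
  then have "ext V ` ext V z = {{x'}, {x', y'}}" by simp
  ultimately show ?thesis by (auto simp: doubleton_eq_iff)
qed

definition mem2 :: "'v sstr \<Rightarrow> 'v \<Rightarrow> 'v \<Rightarrow> 'v \<Rightarrow> bool" where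
  "mem2 V r x y \<longleftrightarrow> (\<exists>z. mem V z r \<and> is_pair V z x y)"

definition mem3 :: "'v sstr \<Rightarrow> 'v \<Rightarrow> 'v \<Rightarrow> 'v \<Rightarrow> 'v \<Rightarrow> bool" where
  "mem3 V r x y z \<longleftrightarrow> (\<exists>q t. mem V q r \<and> is_pair V q x t \<and> is_pair V t y z)"

definition BImp :: "bfm \<Rightarrow> bfm \<Rightarrow> bfm" where
  "BImp \<phi> \<psi> = BNeg (BConj \<phi> (BNeg \<psi>))"

definition BIff :: "bfm \<Rightarrow> bfm \<Rightarrow> bfm" where
  "BIff \<phi> \<psi> = BConj (BImp \<phi> \<psi>) (BImp \<psi> \<phi>)"

definition BEx :: "nat \<Rightarrow> nat \<Rightarrow> bfm \<Rightarrow> bfm" where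
  "BEx i j \<phi> = BNeg (BAll i j (BNeg \<phi>))"

text \<open>The bound variables of the next formulas have indices from 90 on; the parameters must be smaller.\<close>

definition BPair :: "nat \<Rightarrow> nat \<Rightarrow> nat \<Rightarrow> bfm" where
  "BPair z x y = BEx 100 z (BEx 101 z (BConj (BMem x 100) (BConj (BAll 102 100 (BEq 102 x))
     (BConj (BMem x 101) (BConj (BMem y 101)
     (BConj (BAll 102 101 (BImp (BNeg (BEq 102 x)) (BEq 102 y)))
            (BAll 102 z (BImp (BNeg (BEq 102 100)) (BEq 102 101)))))))))"

definition BMem2 :: "nat \<Rightarrow> nat \<Rightarrow> nat \<Rightarrow> bfm" where
  "BMem2 r x y = BEx 90 r (BPair 90 x y)"

definition BMem3 :: "nat \<Rightarrow> nat \<Rightarrow> nat \<Rightarrow> nat \<Rightarrow> bfm" where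
  "BMem3 r x y z = BEx 90 r (BEx 91 90 (BEx 92 91 (BConj (BPair 90 x 92) (BPair 92 y z))))"

lemma bsat_connectives [simp]:
  "bsat V e (BImp \<phi> \<psi>) \<longleftrightarrow> (bsat V e \<phi> \<longrightarrow> bsat V e \<psi>)"
  "bsat V e (BIff \<phi> \<psi>) \<longleftrightarrow> (bsat V e \<phi> \<longleftrightarrow> bsat V e \<psi>)"
  "bsat V e (BEx i j \<phi>) \<longleftrightarrow> (\<exists>x. mem V x (e j) \<and> bsat V (e(i := x)) \<phi>)"
  by (auto simp: BImp_def BIff_def BEx_def)

lemma bsat_BPair:
  assumes "superstructure h V" "z < 100" "x < 100" "y < 100"
  shows "bsat V e (BPair z x y) \<longleftrightarrow> is_pair V (e z) (e x) (e y)"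
proof -
  have "z \<noteq> 100" "z \<noteq> 101" "z \<noteq> 102" "x \<noteq> 100" "x \<noteq> 101" "x \<noteq> 102" "y \<noteq> 100" "y \<noteq> 101" "y \<noteq> 102"
    using assms by auto
  then show ?thesis
    unfolding is_pair_iff_mem[OF assms(1)] BPair_def by (simp add: disj_imp)
qed

lemma bsat_BMem2:
  assumes "superstructure h V" "r < 90" "x < 90" "y < 90"
  shows "bsat V e (BMem2 r x y) \<longleftrightarrow> mem2 V (e r) (e x) (e y)"
  using assms(2-) by (simp add: BMem2_def bsat_BPair[OF assms(1)] mem2_def)

text \<open>The inner pair is not a member of the triple but a member of one of its members.
  Variable 91 of \<open>BMem3\<close> runs through that intermediate set, so that the quantifier
  over the inner pair is bounded.\<close>

lemma bsat_BMem3: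
  assumes "superstructure h V" "r < 90" "x < 90" "y < 90" "z < 90"
  shows "bsat V e (BMem3 r x y z) \<longleftrightarrow> mem3 V (e r) (e x) (e y) (e z)"
proof -
  have "\<exists>b. mem V b q \<and> mem V t b" if "is_pair V q a t" for q a t
    using that unfolding is_pair_iff_mem[OF assms(1)] by blast
  then have "(\<exists>b. mem V b q \<and> (\<exists>t. mem V t b \<and> is_pair V q a t \<and> is_pair V t c d)) \<longleftrightarrow>
      (\<exists>t. is_pair V q a t \<and> is_pair V t c d)" for q a c d
    by metis
  then show ?thesis
    using assms(2-) by (simp add: BMem3_def bsat_BPair[OF assms(1)] mem3_def)
qed

lemma is_tuple_2: "is_tuple V z [x, y] \<longleftrightarrow> is_pair V z x y"
  by simp

lemma is_tuple_3: "is_tuple V z [x, y, w] \<longleftrightarrow> (\<exists>t. is_pair V z x t \<and> is_pair V t y w)"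
  by auto

lemma represents_unique:
  "superstructure h V \<Longrightarrow> represents V r R \<Longrightarrow> represents V r' R \<Longrightarrow> r = r'"
  using set_extensionality[of h V r r'] by (simp add: represents_def)

text \<open>Atoms have level 0 and a Kuratowski pair costs two levels, so triples of atoms have
  level 4 and a set of them has level 5. This is the origin of the height 5.\<close>

lemma ex_represents:
  assumes V: "superstructure h V" "5 \<le> h" and R: "\<And>xs. xs \<in> R \<Longrightarrow> set xs \<subseteq> atoms V \<and> length xs \<in> {1, 2, 3}"
  shows "\<exists>r. represents V r R"
proof -
  have le: "enat k \<le> h" if "k \<le> 5" for k
  proof -
    have "enat k \<le> enat 5" using that by simp
    also have "enat 5 \<le> h" using V(2) by (simp add: numeral_eq_enat)
    finally show ?thesis .
  qed
  \<comment> \<open>Uniqueness is needed besides existence: the representing set collects all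
    \<open>z\<close> that are tuples of \<open>R\<close>, and each of them must be the one that was
    built inside level 4.\<close>
  have tup: "\<exists>z\<in>level V 4. is_tuple V z xs \<and> (\<forall>z'. is_tuple V z' xs \<longrightarrow> z' = z)" if xs: "xs \<in> R" for xs
  proof -
    consider x where "xs = [x]" | x y where "xs = [x, y]" | x y w where "xs = [x, y, w]"
      using R[OF xs] by (auto simp: numeral_2_eq_2 numeral_3_eq_3 length_Suc_conv)
    then show ?thesis
    proof cases
      case (1 x)
      then have "x \<in> level V 0" using R[OF xs] by simp
      then have "x \<in> level V 4" by (rule subsetD[OF level_mono, rotated]) simp
      then show ?thesis unfolding 1 by auto
    next
      case (2 x y)
      then have "x \<in> level V 0" "y \<in> level V 0" using R[OF xs] by simp_all
      then obtain z where z: "z \<in> level V (0 + 2)" "is_pair V z x y"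
        using ex_pair[OF V(1) le, of 0 x y] by auto
      have "z \<in> level V 4" using z(1) by (rule subsetD[OF level_mono, rotated]) simp
      moreover have "z' = z" if "is_pair V z' x y" for z'
        by (rule is_pair_unique[OF V(1) that z(2)])
      ultimately show ?thesis unfolding 2 is_tuple_2 using z(2) by blast
    next
      case (3 x y w)
      then have 0: "x \<in> level V 0" "y \<in> level V 0" "w \<in> level V 0" using R[OF xs] by simp_all
      then obtain t where t: "t \<in> level V (0 + 2)" "is_pair V t y w"
        using ex_pair[OF V(1) le, of 0 y w] by auto
      have "t \<in> level V 2" using t(1) by (rule subsetD[OF level_mono, rotated]) simp
      moreover have "x \<in> level V 2" using 0(1) by (rule subsetD[OF level_mono, rotated]) simp
      ultimately obtain z where z: "z \<in> level V (2 + 2)" "is_pair V z x t"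
        using ex_pair[OF V(1) le, of 2 x t] by auto
      have "z' = z" if "is_pair V z' x t'" "is_pair V t' y w" for z' t'
        using is_pair_unique[OF V(1) that(2) t(2)] is_pair_unique[OF V(1) that(1)] z(2) by blast
      moreover have "z \<in> level V 4" using z(1) by simp
      ultimately show ?thesis unfolding 3 is_tuple_3 using t(2) z(2) by blast
    qed
  qed
  have "{z. \<exists>xs\<in>R. is_tuple V z xs} \<subseteq> level V 4"
  proof clarify
    fix z xs assume "xs \<in> R" "is_tuple V z xs"
    then show "z \<in> level V 4" using tup[of xs] by blast
  qed
  then obtain r where "is_set V r" "ext V r = {z. \<exists>xs\<in>R. is_tuple V z xs}"
    using ex_set_of_level[OF V(1) le, of 4 "{z. \<exists>xs\<in>R. is_tuple V z xs}"] by auto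
  moreover have "\<exists>z. is_tuple V z xs" if "xs \<in> R" for xs using tup[OF that] by blast
  ultimately have "represents V r R" by (simp add: represents_def)
  then show ?thesis by (rule exI)
qed

section \<open>Transfer for hypernatural numbers\<close>

lemma represents_mem: "represents V r R \<Longrightarrow> mem V z r \<longleftrightarrow> (\<exists>xs\<in>R. is_tuple V z xs)"
  by (auto simp: represents_def ext_def)

lemma represents_tuple: "represents V r R \<Longrightarrow> xs \<in> R \<Longrightarrow> \<exists>z. is_tuple V z xs"
  by (simp add: represents_def)

lemma ex_represents_iff:
  assumes "superstructure h V" "represents V r R"
  shows "(\<exists>r' z. represents V r' R \<and> Q r' z) \<longleftrightarrow> (\<exists>z. Q r z)"
  using represents_unique[OF assms] assms(2) by metis

lemma ex_map_pair: "(\<exists>xs\<in>map f ` {[m, n] | m n. Q m n}. \<Phi> xs) \<longleftrightarrow> (\<exists>m n. Q m n \<and> \<Phi> [f m, f n])"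
proof -
  have "(\<exists>xs\<in>{[m, n] | m n. Q m n}. \<Psi> xs) \<longleftrightarrow> (\<exists>m n. Q m n \<and> \<Psi> [m, n])" for \<Psi>
    by blast
  from this[of "\<lambda>xs. \<Phi> (map f xs)"] show ?thesis by (simp only: bex_simps list.map)
qed

lemma ex_map_triple:
  "(\<exists>xs\<in>map f ` {[m, n, k] | m n k. Q m n k}. \<Phi> xs) \<longleftrightarrow> (\<exists>m n k. Q m n k \<and> \<Phi> [f m, f n, f k])"
proof -
  have "(\<exists>xs\<in>{[m, n, k] | m n k. Q m n k}. \<Psi> xs) \<longleftrightarrow> (\<exists>m n k. Q m n k \<and> \<Psi> [m, n, k])" for \<Psi>
    by blast
  from this[of "\<lambda>xs. \<Phi> (map f xs)"] show ?thesis by (simp only: bex_simps list.map)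
qed

locale saturated_extension =
  fixes X :: "('v, 'w) nsext" and h :: enat
  assumes height: "5 \<le> h"
    and extension: "nonstandard_extension h X"
    and saturated: "c_plus_saturated X"
begin

lemma std: "superstructure h (stdV X)" and nst: "superstructure h (nstV X)"
  and inj_natom: "inj_on (natom X) Npos" and atoms_std: "atoms (stdV X) = natom X ` Npos"
  using extension unfolding nonstandard_extension_def by blast+

lemma natom_eq: "0 < m \<Longrightarrow> 0 < n \<Longrightarrow> natom X m = natom X n \<longleftrightarrow> m = n"
  using inj_natom by (auto simp: inj_on_def Npos_def)

lemma transfer: "bsat (stdV X) e \<phi> \<Longrightarrow> bsat (nstV X) (star X \<circ> e) \<phi>"
  using extension unfolding nonstandard_extension_def by blast

definition obj1 :: "nat set \<Rightarrow> 'v" where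
  "obj1 A = (SOME r. represents (stdV X) r (map (natom X) ` {[n] | n. n \<in> A}))"

definition obj2 :: "(nat \<Rightarrow> nat \<Rightarrow> bool) \<Rightarrow> 'v" where
  "obj2 P = (SOME r. represents (stdV X) r
     (map (natom X) ` {[m, n] | m n. m \<in> Npos \<and> n \<in> Npos \<and> P m n}))"

definition obj3 :: "(nat \<Rightarrow> nat \<Rightarrow> nat \<Rightarrow> bool) \<Rightarrow> 'v" where
  "obj3 P = (SOME r. represents (stdV X) r
     (map (natom X) ` {[m, n, k] | m n k. m \<in> Npos \<and> n \<in> Npos \<and> k \<in> Npos \<and> P m n k}))"

text \<open>The extension of a standard set, with the existential witnesses of
  \<open>star_rel\<close> replaced by the single object \<open>obj1 A\<close>. \<open>H2\<close> and
  \<open>H3\<close> do the same for binary and ternary relations.\<close>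

definition H1 :: "nat set \<Rightarrow> 'w \<Rightarrow> bool" where
  "H1 A x \<longleftrightarrow> mem (nstV X) x (star X (obj1 A))"

definition H2 :: "(nat \<Rightarrow> nat \<Rightarrow> bool) \<Rightarrow> 'w \<Rightarrow> 'w \<Rightarrow> bool" where
  "H2 P x y \<longleftrightarrow> mem2 (nstV X) (star X (obj2 P)) x y"

definition H3 :: "(nat \<Rightarrow> nat \<Rightarrow> nat \<Rightarrow> bool) \<Rightarrow> 'w \<Rightarrow> 'w \<Rightarrow> 'w \<Rightarrow> bool" where
  "H3 P x y z \<longleftrightarrow> mem3 (nstV X) (star X (obj3 P)) x y z"

lemma represents_obj1:
  assumes "A \<subseteq> Npos"
  shows "represents (stdV X) (obj1 A) (map (natom X) ` {[n] | n. n \<in> A})"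
  unfolding obj1_def by (rule someI_ex, rule ex_represents[OF std height]) (use assms in \<open>auto simp: atoms_std\<close>)

lemma represents_obj2:
  "represents (stdV X) (obj2 P) (map (natom X) ` {[m, n] | m n. m \<in> Npos \<and> n \<in> Npos \<and> P m n})"
  unfolding obj2_def by (rule someI_ex, rule ex_represents[OF std height]) (auto simp: atoms_std)

lemma represents_obj3:
  "represents (stdV X) (obj3 P)
     (map (natom X) ` {[m, n, k] | m n k. m \<in> Npos \<and> n \<in> Npos \<and> k \<in> Npos \<and> P m n k})"
  unfolding obj3_def by (rule someI_ex, rule ex_represents[OF std height]) (auto simp: atoms_std)

lemma mem_obj1: "A \<subseteq> Npos \<Longrightarrow> mem (stdV X) x (obj1 A) \<longleftrightarrow> (\<exists>n\<in>A. x = natom X n)"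
  unfolding represents_mem[OF represents_obj1] by auto

lemma mem_obj2:
  "mem (stdV X) z (obj2 P) \<longleftrightarrow>
    (\<exists>m n. 0 < m \<and> 0 < n \<and> P m n \<and> is_pair (stdV X) z (natom X m) (natom X n))"
  unfolding represents_mem[OF represents_obj2] ex_map_pair is_tuple_2 by (simp add: Npos_def)

lemma mem_obj3:
  "mem (stdV X) z (obj3 P) \<longleftrightarrow>
    (\<exists>m n k. 0 < m \<and> 0 < n \<and> 0 < k \<and> P m n k \<and>
      (\<exists>t. is_pair (stdV X) z (natom X m) t \<and> is_pair (stdV X) t (natom X n) (natom X k)))"
  unfolding represents_mem[OF represents_obj3] ex_map_triple is_tuple_3 by (simp add: Npos_def)

lemma mem2_obj2:
  assumes "0 < m" "0 < n"
  shows "mem2 (stdV X) (obj2 P) (natom X m) (natom X n) \<longleftrightarrow> P m n"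
proof
  assume "mem2 (stdV X) (obj2 P) (natom X m) (natom X n)"
  then obtain z m' n' where z: "is_pair (stdV X) z (natom X m) (natom X n)" "0 < m'" "0 < n'" "P m' n'"
      "is_pair (stdV X) z (natom X m') (natom X n')"
    unfolding mem2_def mem_obj2 by blast
  then have "m = m'" "n = n'" using is_pair_inject[OF z(1) z(5)] natom_eq assms by auto
  then show "P m n" using z by simp
next
  assume P: "P m n"
  then have "\<exists>z. is_tuple (stdV X) z (map (natom X) [m, n])"
    using assms by (intro represents_tuple[OF represents_obj2[of P]] imageI) (auto simp: Npos_def)
  then show "mem2 (stdV X) (obj2 P) (natom X m) (natom X n)"
    using P assms by (auto simp: mem2_def mem_obj2)
qed

lemma mem3_obj3:
  assumes "0 < m" "0 < n" "0 < k"
  shows "mem3 (stdV X) (obj3 P) (natom X m) (natom X n) (natom X k) \<longleftrightarrow> P m n k"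
proof
  assume "mem3 (stdV X) (obj3 P) (natom X m) (natom X n) (natom X k)"
  then obtain z t m' n' k' t' where z: "is_pair (stdV X) z (natom X m) t" "0 < m'" "0 < n'" "0 < k'" "P m' n' k'"
      "is_pair (stdV X) z (natom X m') t'" "is_pair (stdV X) t (natom X n) (natom X k)"
      "is_pair (stdV X) t' (natom X n') (natom X k')"
    unfolding mem3_def mem_obj3 by blast
  then have "m = m'" "t = t'" using is_pair_inject[OF z(1) z(6)] natom_eq assms by auto
  moreover from this have "n = n'" "k = k'" using is_pair_inject[OF z(7)] z natom_eq assms by auto
  ultimately show "P m n k" using z by simp
next
  assume P: "P m n k"
  then have "\<exists>z. is_tuple (stdV X) z (map (natom X) [m, n, k])"
    using assms by (intro represents_tuple[OF represents_obj3[of P]] imageI) (auto simp: Npos_def)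
  then obtain z t where "is_pair (stdV X) z (natom X m) t" "is_pair (stdV X) t (natom X n) (natom X k)"
    by auto
  then show "mem3 (stdV X) (obj3 P) (natom X m) (natom X n) (natom X k)"
    unfolding mem3_def mem_obj3 using P assms by blast
qed

lemma hin_iff:
  assumes "A \<subseteq> Npos"
  shows "hin X x A \<longleftrightarrow> H1 A x"
  unfolding hin_def star_rel_def ex_represents_iff[OF std represents_obj1[OF assms]] H1_def by simp

lemma star_rel_2:
  "star_rel X {[m, n] | m n. m \<in> Npos \<and> n \<in> Npos \<and> P m n} [x, y] \<longleftrightarrow> H2 P x y"
  unfolding star_rel_def ex_represents_iff[OF std represents_obj2] H2_def mem2_def is_tuple_2 by blast

lemma star_rel_3:
  "star_rel X {[m, n, k] | m n k. m \<in> Npos \<and> n \<in> Npos \<and> k \<in> Npos \<and> P m n k} [x, y, z] \<longleftrightarrow> H3 P x y z"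
  unfolding star_rel_def ex_represents_iff[OF std represents_obj3] H3_def mem3_def is_tuple_3 by blast

lemma all_std: "(\<forall>x. mem (stdV X) x (obj1 Npos) \<longrightarrow> \<Phi> x) \<longleftrightarrow> (\<forall>n>0. \<Phi> (natom X n))"
  by (auto simp: mem_obj1 Npos_def)

lemma ex_std: "(\<exists>x. mem (stdV X) x (obj1 Npos) \<and> \<Phi> x) \<longleftrightarrow> (\<exists>n>0. \<Phi> (natom X n))"
  by (auto simp: mem_obj1 Npos_def)

text \<open>The members of \<open>obj1 Npos\<close> are all the standard atoms, so the clause of
  \<open>nonstandard_extension\<close> about that set applies. It turns quantifiers bounded by
  \<open>obj1 Npos\<close> into quantifiers over the hypernaturals.\<close>

lemma H1_Npos: "H1 Npos x \<longleftrightarrow> x \<in> hnat X"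
proof -
  have "is_set (stdV X) (obj1 Npos)" using represents_obj1[of Npos] by (simp add: represents_def)
  moreover have "ext (stdV X) (obj1 Npos) = atoms (stdV X)"
    by (auto simp: ext_def mem_obj1 atoms_std)
  ultimately have "ext (nstV X) (star X (obj1 Npos)) = hnat X"
    using extension unfolding nonstandard_extension_def by blast
  then show ?thesis by (auto simp: ext_def H1_def)
qed

lemma mem_obj1_natom: "A \<subseteq> Npos \<Longrightarrow> 0 < n \<Longrightarrow> mem (stdV X) (natom X n) (obj1 A) \<longleftrightarrow> n \<in> A"
  using natom_eq by (auto simp: mem_obj1 Npos_def)

lemmas std_simps = mem_obj1_natom bsat_BMem2[OF std] bsat_BMem3[OF std] bsat_BPair[OF std] all_std ex_std mem2_obj2 mem3_obj3 natom_eq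
lemmas nst_simps = bsat_BMem2[OF nst] bsat_BMem3[OF nst] bsat_BPair[OF nst] H1_Npos
  H1_def[symmetric] H2_def[symmetric] H3_def[symmetric]

section \<open>Instances of transfer\<close>

lemma H1_Int:
  assumes "A \<subseteq> Npos" "B \<subseteq> Npos" "x \<in> hnat X"
  shows "H1 (A \<inter> B) x \<longleftrightarrow> H1 A x \<and> H1 B x"
proof -
  \<comment> \<open>The convention for all transferred formulas: variable 0 is the set of all
    numbers, the next few indices hold the parameters, and the variables from 10 on are
    bound.\<close>
  let ?e = "(\<lambda>_. obj1 Npos)(1 := obj1 A, 2 := obj1 B, 3 := obj1 (A \<inter> B))"
  have "A \<inter> B \<subseteq> Npos" using assms by blast
  then have "bsat (stdV X) ?e (BAll 10 0 (BIff (BMem 10 3) (BConj (BMem 10 1) (BMem 10 2))))"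
    using assms by (simp add: std_simps cong: conj_cong)
  from transfer[OF this] show ?thesis using assms by (simp add: nst_simps)
qed

lemma H1_Compl:
  assumes "A \<subseteq> Npos" "x \<in> hnat X"
  shows "H1 (Npos - A) x \<longleftrightarrow> \<not> H1 A x"
proof -
  let ?e = "(\<lambda>_. obj1 Npos)(1 := obj1 A, 2 := obj1 (Npos - A))"
  have "Npos - A \<subseteq> Npos" by blast
  then have "bsat (stdV X) ?e (BAll 10 0 (BIff (BMem 10 2) (BNeg (BMem 10 1))))"
    using assms by (simp add: std_simps) (simp add: Npos_def)
  from transfer[OF this] show ?thesis using assms by (simp add: nst_simps)
qed

text \<open>The descriptions that define \<open>hmult\<close> and \<open>hpow\<close> range over the
  whole nonstandard universe. Their uniqueness therefore needs that a third component of the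
  relation is a hypernatural at all, which is transferred from the fact that its standard members
  are triples of numbers.\<close>

lemma H3_hnat:
  assumes "H3 P x y z"
  shows "z \<in> hnat X"
proof -
  let ?e = "(\<lambda>_. obj1 Npos)(1 := obj3 P)"
  have "bsat (stdV X) ?e (BAll 13 1 (BEx 10 0 (BEx 11 0 (BEx 12 0
      (BEx 14 13 (BEx 15 14 (BConj (BPair 13 10 15) (BPair 15 11 12))))))))"
    unfolding bsat.simps
  proof (intro allI impI)
    fix q assume "mem (stdV X) q (((\<lambda>_. obj1 Npos)(1 := obj3 P)) 1)"
    then obtain m n k t where q: "0 < m" "0 < n" "0 < k" "is_pair (stdV X) q (natom X m) t"
        "is_pair (stdV X) t (natom X n) (natom X k)" by (auto simp: mem_obj3)
    then obtain b where "mem (stdV X) b q" "mem (stdV X) t b" unfolding is_pair_iff_mem[OF std] by blast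
    with q show "bsat (stdV X) (?e(13 := q)) (BEx 10 0 (BEx 11 0 (BEx 12 0
      (BEx 14 13 (BEx 15 14 (BConj (BPair 13 10 15) (BPair 15 11 12)))))))"
      by (simp add: std_simps) blast
  qed
  from transfer[OF this] have *: "\<forall>q. mem (nstV X) q (star X (obj3 P)) \<longrightarrow> (\<exists>x'\<in>hnat X. \<exists>y'\<in>hnat X. \<exists>z'\<in>hnat X.
      \<exists>t. is_pair (nstV X) q x' t \<and> is_pair (nstV X) t y' z')"
    by (simp add: nst_simps) blast
  obtain q t where q: "mem (nstV X) q (star X (obj3 P))" "is_pair (nstV X) q x t" "is_pair (nstV X) t y z"
    using assms unfolding H3_def mem3_def by blast
  then obtain x' y' z' t' where "z' \<in> hnat X" "is_pair (nstV X) q x' t'" "is_pair (nstV X) t' y' z'"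
    using * by blast
  then show ?thesis using is_pair_inject q(2,3) by metis
qed

lemma ex_H2:
  assumes "\<And>m. 0 < m \<Longrightarrow> \<exists>n>0. P m n" "x \<in> hnat X"
  shows "\<exists>y\<in>hnat X. H2 P x y"
proof -
  let ?e = "(\<lambda>_. obj1 Npos)(1 := obj2 P)"
  have "bsat (stdV X) ?e (BAll 10 0 (BEx 11 0 (BMem2 1 10 11)))"
    using assms(1) by (simp add: std_simps cong: conj_cong)
  from transfer[OF this] show ?thesis using assms(2) by (auto simp: nst_simps)
qed

lemma ex_H2_2:
  assumes "\<And>m n. 0 < m \<Longrightarrow> 0 < n \<Longrightarrow> \<exists>k>0. P k m \<and> Q k n" "x \<in> hnat X" "y \<in> hnat X"
  shows "\<exists>z\<in>hnat X. H2 P z x \<and> H2 Q z y"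
proof -
  let ?e = "(\<lambda>_. obj1 Npos)(1 := obj2 P, 2 := obj2 Q)"
  have "bsat (stdV X) ?e (BAll 10 0 (BAll 11 0 (BEx 12 0 (BConj (BMem2 1 12 10) (BMem2 2 12 11)))))"
    using assms(1) by (simp add: std_simps cong: conj_cong)
  from transfer[OF this] show ?thesis using assms(2,3) by (auto simp: nst_simps)
qed

text \<open>In the applications \<open>P\<close> is the graph of a function and \<open>A\<close> the
  preimage of \<open>B\<close>, so that a question about the value \<open>x\<close> becomes one
  about the argument \<open>c\<close>. The next three lemmas serve the same purpose for equality,
  binary relations and ternary relations.\<close>

lemma H1_iff:
  assumes "\<And>m n. 0 < m \<Longrightarrow> 0 < n \<Longrightarrow> P m n \<Longrightarrow> n \<in> B \<longleftrightarrow> m \<in> A"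
    and "c \<in> hnat X" "x \<in> hnat X" "H2 P c x" "A \<subseteq> Npos" "B \<subseteq> Npos"
  shows "H1 B x \<longleftrightarrow> H1 A c"
proof -
  let ?e = "(\<lambda>_. obj1 Npos)(1 := obj1 A, 2 := obj1 B, 3 := obj2 P)"
  have "bsat (stdV X) ?e (BAll 10 0 (BAll 11 0 (BImp (BMem2 3 10 11) (BIff (BMem 11 2) (BMem 10 1)))))"
    using assms(1,5,6) by (simp add: std_simps cong: conj_cong)
  from transfer[OF this] show ?thesis using assms by (auto simp: nst_simps)
qed

lemma eq_iff_H1:
  assumes "\<And>m n k. 0 < m \<Longrightarrow> 0 < n \<Longrightarrow> 0 < k \<Longrightarrow> P m n \<Longrightarrow> Q m k \<Longrightarrow> n = k \<longleftrightarrow> m \<in> A"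
    and "c \<in> hnat X" "x \<in> hnat X" "y \<in> hnat X" "H2 P c x" "H2 Q c y" "A \<subseteq> Npos"
  shows "x = y \<longleftrightarrow> H1 A c"
proof -
  let ?e = "(\<lambda>_. obj1 Npos)(1 := obj1 A, 2 := obj2 P, 3 := obj2 Q)"
  have "bsat (stdV X) ?e (BAll 10 0 (BAll 11 0 (BAll 12 0 (BImp (BMem2 2 10 11) (BImp (BMem2 3 10 12)
      (BIff (BEq 11 12) (BMem 10 1)))))))"
    using assms(1,7) by (simp add: std_simps cong: conj_cong)
  from transfer[OF this] show ?thesis using assms(2-) by (simp add: nst_simps)
qed

lemma H2_iff_H1:
  assumes "\<And>m n k. 0 < m \<Longrightarrow> 0 < n \<Longrightarrow> 0 < k \<Longrightarrow> P m n \<Longrightarrow> Q m k \<Longrightarrow> R n k \<longleftrightarrow> m \<in> A"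
    and "c \<in> hnat X" "x \<in> hnat X" "y \<in> hnat X" "H2 P c x" "H2 Q c y" "A \<subseteq> Npos"
  shows "H2 R x y \<longleftrightarrow> H1 A c"
proof -
  let ?e = "(\<lambda>_. obj1 Npos)(1 := obj1 A, 2 := obj2 P, 3 := obj2 Q, 4 := obj2 R)"
  have "bsat (stdV X) ?e (BAll 10 0 (BAll 11 0 (BAll 12 0 (BImp (BMem2 2 10 11) (BImp (BMem2 3 10 12)
      (BIff (BMem2 4 11 12) (BMem 10 1)))))))"
    using assms(1,7) by (simp add: std_simps cong: conj_cong)
  from transfer[OF this] show ?thesis using assms(2-) by (simp add: nst_simps)
qed

lemma H3_iff_H1:
  assumes "\<And>m n k l. 0 < m \<Longrightarrow> 0 < n \<Longrightarrow> 0 < k \<Longrightarrow> 0 < l \<Longrightarrow> P m n \<Longrightarrow> Q m k \<Longrightarrow> T m l \<Longrightarrow> R n k l \<longleftrightarrow> m \<in> A"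
    and "c \<in> hnat X" "x \<in> hnat X" "y \<in> hnat X" "z \<in> hnat X" "H2 P c x" "H2 Q c y" "H2 T c z" "A \<subseteq> Npos"
  shows "H3 R x y z \<longleftrightarrow> H1 A c"
proof -
  let ?e = "(\<lambda>_. obj1 Npos)(1 := obj1 A, 2 := obj2 P, 3 := obj2 Q, 4 := obj2 T, 5 := obj3 R)"
  have "bsat (stdV X) ?e (BAll 10 0 (BAll 11 0 (BAll 12 0 (BAll 13 0 (BImp (BMem2 2 10 11) (BImp (BMem2 3 10 12)
      (BImp (BMem2 4 10 13) (BIff (BMem3 5 11 12 13) (BMem 10 1)))))))))"
    using assms(1,9) by (simp add: std_simps cong: conj_cong)
  from transfer[OF this] show ?thesis using assms(2-) by (simp add: nst_simps)
qed

lemma H2_trans: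
  assumes "\<And>m n k. 0 < m \<Longrightarrow> 0 < n \<Longrightarrow> 0 < k \<Longrightarrow> P m n \<Longrightarrow> Q n k \<Longrightarrow> R m k"
    and "x \<in> hnat X" "y \<in> hnat X" "z \<in> hnat X" "H2 P x y" "H2 Q y z"
  shows "H2 R x z"
proof -
  let ?e = "(\<lambda>_. obj1 Npos)(1 := obj2 P, 2 := obj2 Q, 3 := obj2 R)"
  have "bsat (stdV X) ?e (BAll 10 0 (BAll 11 0 (BAll 12 0 (BImp (BMem2 1 10 11) (BImp (BMem2 2 11 12)
      (BMem2 3 10 12))))))"
    using assms(1) by (simp add: std_simps cong: conj_cong)
  from transfer[OF this] show ?thesis using assms(2-) by (simp add: nst_simps)
qed

section \<open>Internal sections and saturation\<close>

lemma ex_internal_section: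
  assumes "y \<in> hnat X"
  shows "\<exists>s. internal_set X s \<and> (\<forall>z. mem (nstV X) z s \<longleftrightarrow> z \<in> hnat X \<and> H2 P z y)"
proof -
  have sub: "natom X ` A \<subseteq> level (stdV X) 0" if "A \<subseteq> Npos" for A
    using that by (auto simp: atoms_std)
  have h: "enat (Suc 0) \<le> h" "enat (Suc 1) \<le> h"
    using height by (cases h; simp add: numeral_eq_enat)+
  \<comment> \<open>\<open>pw\<close> is the power set of the numbers. It bounds the quantifier over
    sections in the transferred formula, and membership in its extension is what makes
    \<open>s\<close> internal.\<close>
  have "{y. is_set (stdV X) y \<and> ext (stdV X) y \<subseteq> atoms (stdV X)} \<subseteq> level (stdV X) 1" by auto
  from ex_set_of_level[OF std h(2) this] obtain pw where pw: "is_set (stdV X) pw"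
      "ext (stdV X) pw = {y. is_set (stdV X) y \<and> ext (stdV X) y \<subseteq> atoms (stdV X)}" by blast
  have mem_pw: "mem (stdV X) s pw \<longleftrightarrow> is_set (stdV X) s \<and> ext (stdV X) s \<subseteq> atoms (stdV X)" for s
    using pw(2) by (auto simp: ext_def)
  have N: "mem (stdV X) x (obj1 Npos) \<longleftrightarrow> x \<in> atoms (stdV X)" for x
    by (auto simp: mem_obj1 atoms_std)
  let ?e = "(\<lambda>_. obj1 Npos)(1 := obj2 P, 2 := pw)"
  have "bsat (stdV X) ?e (BAll 10 0 (BEx 11 2 (BAll 12 0 (BIff (BMem 12 11) (BMem2 1 12 10)))))"
  proof -
    have "\<exists>s. mem (stdV X) s pw \<and> (\<forall>m>0. mem (stdV X) (natom X m) s \<longleftrightarrow> P m n)" for n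
    proof -
      obtain s where s: "is_set (stdV X) s" "ext (stdV X) s = natom X ` {m \<in> Npos. P m n}"
        using ex_set_of_level[OF std h(1) sub, of "{m \<in> Npos. P m n}"] by blast
      have "mem (stdV X) (natom X m) s \<longleftrightarrow> natom X m \<in> natom X ` {m \<in> Npos. P m n}" for m
        using s(2) by (auto simp: ext_def)
      moreover have "natom X m \<in> natom X ` {m \<in> Npos. P m n} \<longleftrightarrow> P m n" if "0 < m" for m
        using natom_eq that by (auto simp: Npos_def)
      moreover have "mem (stdV X) s pw" using s by (auto simp: mem_pw atoms_std)
      ultimately show ?thesis by blast
    qed
    then show ?thesis by (simp add: std_simps cong: conj_cong)
  qed
  from transfer[OF this] obtain s where s: "mem (nstV X) s (star X pw)"
      "\<And>z. z \<in> hnat X \<Longrightarrow> mem (nstV X) z s \<longleftrightarrow> H2 P z y"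
    using assms by (auto simp: nst_simps)
  \<comment> \<open>The first transfer decides only which hypernaturals belong to \<open>s\<close>.
    The second one excludes all other members and shows that \<open>s\<close> is not an
    atom.\<close>
  have "bsat (stdV X) ?e (BAll 10 2 (BConj (BNeg (BMem 10 0)) (BAll 11 10 (BMem 11 0))))"
    by (auto simp: N mem_pw is_set_def ext_def)
  from transfer[OF this] have "s \<notin> hnat X" "\<And>z. mem (nstV X) z s \<Longrightarrow> z \<in> hnat X"
    using s(1) by (auto simp: nst_simps)
  then have "internal_set X s" "\<And>z. mem (nstV X) z s \<longleftrightarrow> z \<in> hnat X \<and> H2 P z y"
    using s pw(1) unfolding internal_set_def is_set_def by auto
  then show ?thesis by blast
qed

text \<open>The sections at \<open>y\<close> are internal, and there are at most continuum many,
  because a binary relation on numbers is coded by a set of numbers. That is the size of family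
  which \<open>c_plus_saturated\<close> admits.\<close>

lemma saturation:
  assumes y: "y \<in> hnat X"
    and fip: "\<And>\<S>. \<S> \<subseteq> \<R> \<Longrightarrow> finite \<S> \<Longrightarrow> \<exists>z\<in>hnat X. \<forall>P\<in>\<S>. H2 P z y"
  shows "\<exists>z\<in>hnat X. \<forall>P\<in>\<R>. H2 P z y"
\<comment> \<open>For the empty family saturation promises just some object, which need not be a
  hypernatural; \<open>y\<close> itself serves as the witness.\<close>
proof (cases "\<R> = {}")
  case True
  then show ?thesis using y by blast
next
  case False
  define s where "s P = (SOME s. internal_set X s \<and> (\<forall>z. mem (nstV X) z s \<longleftrightarrow> z \<in> hnat X \<and> H2 P z y))" for P
  have s: "internal_set X (s P) \<and> (\<forall>z. mem (nstV X) z (s P) \<longleftrightarrow> z \<in> hnat X \<and> H2 P z y)" for P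
    unfolding s_def by (rule someI_ex) (rule ex_internal_section[OF y])
  have "inj_on (\<lambda>P. {k. case prod_decode k of (m, n) \<Rightarrow> P m n}) \<R>"
  proof (intro inj_onI ext)
    fix P Q :: "nat \<Rightarrow> nat \<Rightarrow> bool" and m n
    assume "{k. case prod_decode k of (m, n) \<Rightarrow> P m n} = {k. case prod_decode k of (m, n) \<Rightarrow> Q m n}"
    from arg_cong[OF this, of "\<lambda>S. prod_encode (m, n) \<in> S"] show "P m n = Q m n" by simp
  qed
  then have "\<R> \<lesssim> (UNIV :: nat set set)" unfolding lepoll_def by blast
  also have "(UNIV :: nat set set) \<lesssim> (UNIV :: real set)"
    by (rule eqpoll_imp_lepoll[OF nat_sets_eqpoll_reals])
  finally have "s ` \<R> \<lesssim> (UNIV :: real set)"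
    by (rule lepoll_trans[OF image_lepoll])
  moreover have "\<forall>a\<in>s ` \<R>. internal_set X a" using s by blast
  moreover have "\<exists>x. \<forall>b\<in>\<B>. mem (nstV X) x b" if \<B>: "\<B> \<subseteq> s ` \<R>" "finite \<B>" for \<B>
  proof -
    obtain \<S> where "\<S> \<subseteq> \<R>" "finite \<S>" "\<B> = s ` \<S>" using finite_subset_image[OF \<B>(2,1)] by blast
    then show ?thesis using fip[of \<S>] s by blast
  qed
  ultimately obtain x where "\<forall>a\<in>s ` \<R>. mem (nstV X) x a"
    using saturated unfolding c_plus_saturated_def by blast
  then show ?thesis using s False by blast
qed

section \<open>Types, and hypernaturals as values of standard functions\<close>

lemma tp_betaN:
  assumes "x \<in> hnat X"
  shows "tp X x \<in> betaN"
proof -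
  have mem: "A \<in> tp X x \<longleftrightarrow> A \<subseteq> Npos \<and> H1 A x" for A
    unfolding tp_def using hin_iff by blast
  have 1: "H1 Npos x" using assms by (simp add: H1_Npos)
  have 0: "\<not> H1 {} x" using H1_Compl[OF subset_refl assms] 1 by simp
  show ?thesis unfolding betaN_def
  proof (intro CollectI conjI ballI allI impI)
    show "tp X x \<subseteq> Pow Npos" "Npos \<in> tp X x" "{} \<notin> tp X x" using 0 1 by (auto simp: mem)
    show "A \<inter> B \<in> tp X x" if "A \<in> tp X x" "B \<in> tp X x" for A B
      using that H1_Int[of A B x] assms by (auto simp: mem)
    show "B \<in> tp X x" if "A \<in> tp X x" "A \<subseteq> B \<and> B \<subseteq> Npos" for A B
      using that H1_Int[of A B x] assms by (auto simp: mem Int_absorb2)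
    show "A \<in> tp X x \<or> Npos - A \<in> tp X x" if "A \<subseteq> Npos" for A
      using that H1_Compl[OF that assms] by (auto simp: mem)
  qed
qed

lemma H1_uae: "x \<in> hnat X \<Longrightarrow> H1 {n \<in> Npos. \<Phi> n} x \<longleftrightarrow> uae (tp X x) \<Phi>"
  unfolding uae_def tp_def by (simp add: hin_iff)

text \<open>\<open>codes c x g\<close>: the hypernatural \<open>x\<close> is the value at \<open>c\<close> of the extension of the function \<open>g\<close>.
  Statements about finitely many hypernaturals with a common code \<open>c\<close> reduce to
  statements that hold almost everywhere for the type of \<open>c\<close>.\<close>

definition codes :: "'w \<Rightarrow> 'w \<Rightarrow> (nat \<Rightarrow> nat) \<Rightarrow> bool" where
  "codes c x g \<longleftrightarrow> c \<in> hnat X \<and> x \<in> hnat X \<and> (\<forall>n>0. 0 < g n) \<and> H2 (\<lambda>m n. n = g m) c x"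

lemma codesD: "codes c x g \<Longrightarrow> c \<in> hnat X" "codes c x g \<Longrightarrow> x \<in> hnat X"
    "codes c x g \<Longrightarrow> 0 < n \<Longrightarrow> 0 < g n"
  unfolding codes_def by blast+

lemma ex_codes:
  assumes "c \<in> hnat X" "\<And>n. 0 < n \<Longrightarrow> 0 < g n"
  shows "\<exists>x. codes c x g"
proof -
  have "\<exists>x\<in>hnat X. H2 (\<lambda>m n. n = g m) c x"
    by (rule ex_H2[OF _ assms(1)]) (use assms(2) in auto)
  then show ?thesis using assms unfolding codes_def by blast
qed

lemma codes_self:
  assumes "c \<in> hnat X"
  shows "codes c c (\<lambda>n. n)"
proof -
  let ?e = "(\<lambda>_. obj1 Npos)(1 := obj2 (\<lambda>m n. n = m))"
  have "bsat (stdV X) ?e (BAll 10 0 (BMem2 1 10 10))" by (simp add: std_simps)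
  from transfer[OF this] show ?thesis using assms by (simp add: nst_simps codes_def)
qed

lemma codes_comp:
  assumes "codes d c k" "codes c x g"
  shows "codes d x (\<lambda>n. g (k n))"
proof -
  have "H2 (\<lambda>m n. n = g (k m)) d x"
    by (rule H2_trans[of "\<lambda>m n. n = k m" "\<lambda>m n. n = g m" _ d c x]) (use assms in \<open>auto simp: codes_def\<close>)
  then show ?thesis using assms unfolding codes_def by blast
qed

text \<open>Transfer of the fact that one number codes a pair of numbers. The shifts by 1 mediate
  between \<open>prod_decode\<close>, which works from 0 on, and the positive numbers.\<close>

lemma ex_common_code:
  assumes "x \<in> hnat X" "y \<in> hnat X"
  obtains c g k where "codes c x g" "codes c y k"
proof -
  define g where "g n = Suc (fst (prod_decode (n - 1)))" for n
  define k where "k n = Suc (snd (prod_decode (n - 1)))" for n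
  have "\<exists>c\<in>hnat X. H2 (\<lambda>m n. n = g m) c x \<and> H2 (\<lambda>m n. n = k m) c y"
  proof (rule ex_H2_2[OF _ assms])
    fix m n :: nat assume "0 < m" "0 < n"
    then show "\<exists>l>0. m = g l \<and> n = k l"
      by (intro exI[of _ "Suc (prod_encode (m - 1, n - 1))"]) (simp add: g_def k_def)
  qed
  then show ?thesis using that[of _ g k] assms unfolding codes_def g_def k_def by blast
qed

text \<open>Together with \<open>codes_eq\<close>, \<open>codes_H2\<close> and
  \<open>codes_H3\<close> this takes the place of Los's theorem: the type of \<open>c\<close> is the
  ultrafilter, and the functions are the representatives.\<close>

lemma codes_uae:
  assumes "codes c x g"
  shows "uae (tp X x) \<Phi> \<longleftrightarrow> uae (tp X c) (\<lambda>n. \<Phi> (g n))"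
proof -
  have "H1 {n \<in> Npos. \<Phi> n} x \<longleftrightarrow> H1 {n \<in> Npos. \<Phi> (g n)} c"
    by (rule H1_iff[of "\<lambda>m n. n = g m"]) (use assms in \<open>auto simp: codes_def Npos_def\<close>)
  then show ?thesis using assms by (simp add: H1_uae codes_def)
qed

lemma codes_hin:
  assumes "codes c x g" "A \<subseteq> Npos"
  shows "hin X x A \<longleftrightarrow> uae (tp X c) (\<lambda>n. g n \<in> A)"
proof -
  have "{n \<in> Npos. n \<in> A} = A" using assms(2) by blast
  then have "hin X x A \<longleftrightarrow> uae (tp X x) (\<lambda>n. n \<in> A)"
    using H1_uae[of x "\<lambda>n. n \<in> A"] hin_iff[OF assms(2), of x] codesD(2)[OF assms(1)] by simp
  then show ?thesis using codes_uae[OF assms(1)] by simp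
qed

lemma codes_eq:
  assumes "codes c x g" "codes c y k"
  shows "x = y \<longleftrightarrow> uae (tp X c) (\<lambda>n. g n = k n)"
proof -
  have "x = y \<longleftrightarrow> H1 {n \<in> Npos. g n = k n} c"
    by (rule eq_iff_H1[of "\<lambda>m n. n = g m" "\<lambda>m n. n = k m"]) (use assms in \<open>auto simp: codes_def Npos_def\<close>)
  then show ?thesis using assms by (simp add: H1_uae codes_def)
qed

lemma codes_H2:
  assumes "codes c x g" "codes c y k"
  shows "H2 P x y \<longleftrightarrow> uae (tp X c) (\<lambda>n. P (g n) (k n))"
proof -
  have "H2 P x y \<longleftrightarrow> H1 {n \<in> Npos. P (g n) (k n)} c"
    by (rule H2_iff_H1[of "\<lambda>m n. n = g m" "\<lambda>m n. n = k m"]) (use assms in \<open>auto simp: codes_def Npos_def\<close>)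
  then show ?thesis using assms by (simp add: H1_uae codes_def)
qed

lemma codes_H3:
  assumes "codes c x g" "codes c y k" "codes c z l"
  shows "H3 P x y z \<longleftrightarrow> uae (tp X c) (\<lambda>n. P (g n) (k n) (l n))"
proof -
  have "H3 P x y z \<longleftrightarrow> H1 {n \<in> Npos. P (g n) (k n) (l n)} c"
    by (rule H3_iff_H1[of "\<lambda>m n. n = g m" "\<lambda>m n. n = k m" "\<lambda>m n. n = l m"])
      (use assms in \<open>auto simp: codes_def Npos_def\<close>)
  then show ?thesis using assms by (simp add: H1_uae codes_def)
qed

lemma hless_iff: "codes c x g \<Longrightarrow> codes c y k \<Longrightarrow> hless X x y \<longleftrightarrow> uae (tp X c) (\<lambda>n. g n < k n)"
  unfolding hless_def star_rel_2 by (rule codes_H2)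

lemma hdvd_iff: "codes c x g \<Longrightarrow> codes c y k \<Longrightarrow> hdvd X x y \<longleftrightarrow> uae (tp X c) (\<lambda>n. g n dvd k n)"
  unfolding hdvd_def star_rel_2 by (rule codes_H2)

lemma codes_the_H3:
  assumes x: "codes c x g" and y: "codes c y k" and f: "\<And>m n. 0 < m \<Longrightarrow> 0 < n \<Longrightarrow> 0 < f m n"
  shows "codes c (THE z. H3 (\<lambda>m n l. l = f m n) x y z) (\<lambda>n. f (g n) (k n))"
proof -
  have c: "c \<in> hnat X" using codesD(1)[OF x] .
  have "\<exists>z. codes c z (\<lambda>n. f (g n) (k n))"
    by (rule ex_codes[OF c]) (intro f codesD(3)[OF x] codesD(3)[OF y])
  then obtain z where z: "codes c z (\<lambda>n. f (g n) (k n))" by (elim exE)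
  have "(THE z. H3 (\<lambda>m n l. l = f m n) x y z) = z"
  proof (rule the_equality)
    show "H3 (\<lambda>m n l. l = f m n) x y z"
      unfolding codes_H3[OF x y z] by (rule uae_all[OF tp_betaN[OF c]]) simp
  next
    fix z' assume z': "H3 (\<lambda>m n l. l = f m n) x y z'"
    \<comment> \<open>A priori \<open>z'\<close> is not the value of a standard function at
      \<open>c\<close>. Hence \<open>c\<close> and \<open>z'\<close> get a common code
      \<open>d\<close>, and the codes at \<open>c\<close> are pulled back to
      \<open>d\<close>.\<close>
    obtain d j l where d: "codes d c j" "codes d z' l"
      using ex_common_code[OF c H3_hnat[OF z']] .
    note xyz = codes_comp[OF d(1) x] codes_comp[OF d(1) y] codes_comp[OF d(1) z]
    show "z' = z" unfolding codes_eq[OF d(2) xyz(3)] using z' unfolding codes_H3[OF xyz(1,2) d(2)] .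
  qed
  then show ?thesis using z by simp
qed

lemma codes_hmult:
  assumes "codes c x g" "codes c y k"
  shows "codes c (hmult X x y) (\<lambda>n. g n * k n)"
proof -
  have "{[m, n, m * n] | m n. m \<in> Npos \<and> n \<in> Npos}
      = {[m, n, l] | m n l. m \<in> Npos \<and> n \<in> Npos \<and> l \<in> Npos \<and> l = m * n}"
    by (auto simp: Npos_def)
  then have "hmult X x y = (THE z. H3 (\<lambda>m n l. l = m * n) x y z)"
    unfolding hmult_def star_rel_3[symmetric] by simp
  then show ?thesis using codes_the_H3[OF assms, of "\<lambda>m n. m * n"] by simp
qed

lemma codes_hpow:
  assumes "codes c x g" "codes c y k"
  shows "codes c (hpow X x y) (\<lambda>n. g n ^ k n)"
proof -
  have "{[m, n, m ^ n] | m n. m \<in> Npos \<and> n \<in> Npos}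
      = {[m, n, l] | m n l. m \<in> Npos \<and> n \<in> Npos \<and> l \<in> Npos \<and> l = m ^ n}"
    by (auto simp: Npos_def)
  then have "hpow X x y = (THE z. H3 (\<lambda>m n l. l = m ^ n) x y z)"
    unfolding hpow_def star_rel_3[symmetric] by simp
  then show ?thesis using codes_the_H3[OF assms, of "\<lambda>m n. m ^ n"] by simp
qed

section \<open>Basic classes\<close>

text \<open>In a directed family, finitely many relations are implied by a single \<open>R\<close>
  of the family, and a pointwise choice of witnesses for \<open>R\<close> is a standard function
  whose value at \<open>y\<close> is the required \<open>z\<close>. The default 1 in the choice
  keeps that function positive, as \<open>codes\<close> demands.\<close>

lemma saturation_directed:
  assumes y: "y \<in> hnat X" and ne: "\<R> \<noteq> {}"
    and dir: "\<And>P Q. P \<in> \<R> \<Longrightarrow> Q \<in> \<R> \<Longrightarrow> \<exists>R\<in>\<R>. \<forall>m n. R m n \<longrightarrow> P m n \<and> Q m n"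
    and ex: "\<And>P. P \<in> \<R> \<Longrightarrow> uae (tp X y) (\<lambda>n. \<exists>m>0. P m n)"
  shows "\<exists>z\<in>hnat X. \<forall>P\<in>\<R>. H2 P z y"
proof (rule saturation[OF y])
  fix \<S> assume "\<S> \<subseteq> \<R>" "finite \<S>"
  have "\<exists>R\<in>\<R>. \<forall>P\<in>\<S>. \<forall>m n. R m n \<longrightarrow> P m n"
    using \<open>finite \<S>\<close> \<open>\<S> \<subseteq> \<R>\<close>
  proof (induction \<S> rule: finite_induct)
    case empty
    then show ?case using ne by auto
  next
    case (insert Q \<S>)
    then obtain R where R: "R \<in> \<R>" "\<forall>P\<in>\<S>. \<forall>m n. R m n \<longrightarrow> P m n" by blast
    moreover have "Q \<in> \<R>" using insert by blast
    ultimately obtain R' where "R' \<in> \<R>" "\<forall>m n. R' m n \<longrightarrow> Q m n \<and> R m n" using dir by blast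
    then show ?case using R by (intro bexI[of _ R']) auto
  qed
  then obtain R where R: "R \<in> \<R>" "\<forall>P\<in>\<S>. \<forall>m n. R m n \<longrightarrow> P m n" by blast
  define g where "g n = (if \<exists>m>0. R m n then SOME m. 0 < m \<and> R m n else 1)" for n
  have g: "0 < g n \<and> R (g n) n" if "\<exists>m>0. R m n" for n
    using someI_ex[of "\<lambda>m. 0 < m \<and> R m n"] that by (simp add: g_def)
  have "0 < g n" for n
  proof (cases "\<exists>m>0. R m n")
    case False
    then have "g n = 1" unfolding g_def by (rule if_not_P)
    then show ?thesis by simp
  qed (use g in blast)
  then obtain z where z: "codes y z g" using ex_codes[OF y] by blast
  have "H2 P z y" if "P \<in> \<S>" for P
    unfolding codes_H2[OF z codes_self[OF y]]
    by (rule uae_mono[OF tp_betaN[OF y] ex[OF R(1)]]) (use g R(2) that in blast)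
  then show "\<exists>z\<in>hnat X. \<forall>P\<in>\<S>. H2 P z y" using codesD(2)[OF z] by blast
qed

lemma ex_hnat: "\<exists>x. x \<in> hnat X"
proof -
  have "bsat (stdV X) (\<lambda>_. obj1 Npos) (BEx 10 0 (BEq 10 10))"
    by (auto simp: mem_obj1 Npos_def)
  from transfer[OF this] show ?thesis by (simp add: nst_simps)
qed

text \<open>The sets in \<open>F\<close> are nonempty and closed under intersection, so saturation
  finds a point in all their extensions. They are read as binary relations that ignore the second
  argument, to fit the form of saturation at an arbitrary hypernatural \<open>y\<close>.\<close>

lemma ex_generator:
  assumes F: "F \<in> betaN"
  shows "\<exists>x. generator X x F"
proof -
  obtain y where y: "y \<in> hnat X" using ex_hnat by blast
  note T = tp_betaN[OF y]
  have "\<exists>z\<in>hnat X. \<forall>P\<in>(\<lambda>A (m::nat) (n::nat). m \<in> A) ` F. H2 P z y"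
  proof (rule saturation_directed[OF y])
    show "(\<lambda>A (m::nat) (n::nat). m \<in> A) ` F \<noteq> {}" using F by (auto simp: betaN_def)
    show "\<exists>R\<in>(\<lambda>A (m::nat) (n::nat). m \<in> A) ` F. \<forall>m n. R m n \<longrightarrow> P m n \<and> Q m n"
      if "P \<in> (\<lambda>A (m::nat) (n::nat). m \<in> A) ` F" "Q \<in> (\<lambda>A (m::nat) (n::nat). m \<in> A) ` F" for P Q
    proof -
      obtain A B where AB: "A \<in> F" "B \<in> F" "P = (\<lambda>m n. m \<in> A)" "Q = (\<lambda>m n. m \<in> B)" using \<open>P \<in> _\<close> \<open>Q \<in> _\<close> by blast
      have "(\<lambda>m n. m \<in> A \<inter> B) \<in> (\<lambda>A (m::nat) (n::nat). m \<in> A) ` F"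
        by (rule image_eqI[OF refl betaN_Int[OF F AB(1,2)]])
      then show ?thesis using AB(3,4) by (intro bexI[of _ "\<lambda>m n. m \<in> A \<inter> B"]) simp_all
    qed
    show "uae (tp X y) (\<lambda>n. \<exists>m>0. P m n)" if "P \<in> (\<lambda>A (m::nat) (n::nat). m \<in> A) ` F" for P
    proof -
      obtain A where A: "A \<in> F" "P = (\<lambda>m n. m \<in> A)" using \<open>P \<in> _\<close> by blast
      then have "A \<noteq> {}" "A \<subseteq> Npos" using F by (auto simp: betaN_def)
      then have "\<exists>m>0. m \<in> A" by (auto simp: Npos_def)
      then show ?thesis unfolding A(2) by (intro uae_all[OF T])
    qed
  qed
  then obtain z where z: "z \<in> hnat X" "\<And>A. A \<in> F \<Longrightarrow> H2 (\<lambda>m n. m \<in> A) z y" by blast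
  obtain d g k where d: "codes d z g" "codes d y k" using ex_common_code[OF z(1) y] .
  have "F = tp X z"
  proof (rule betaN_eqI[OF F tp_betaN[OF z(1)]])
    fix \<Phi> assume "uae F \<Phi>"
    then have "H2 (\<lambda>m n. m \<in> {n \<in> Npos. \<Phi> n}) z y" unfolding uae_def by (rule z(2))
    then have "uae (tp X d) (\<lambda>n. g n \<in> {n \<in> Npos. \<Phi> n})" unfolding codes_H2[OF d] .
    then show "uae (tp X z) \<Phi>" unfolding codes_uae[OF d(1)]
      by (rule uae_mono[OF tp_betaN[OF codesD(1)[OF d(1)]]]) simp
  qed
  then show ?thesis using z(1) unfolding generator_def by blast
qed

lemma tdvd_tp:
  assumes "codes c x g" "codes c y k" "uae (tp X c) (\<lambda>n. g n dvd k n)"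
  shows "tdvd (tp X x) (tp X y)"
proof (rule tdvdI_upward)
  note c = tp_betaN[OF codesD(1)[OF assms(1)]]
  show "tp X x \<in> betaN" "tp X y \<in> betaN" using assms codesD(2) tp_betaN by blast+
  fix \<Phi> assume "uae (tp X x) \<Phi>" and up: "\<And>m n. 0 < n \<Longrightarrow> m dvd n \<Longrightarrow> \<Phi> m \<Longrightarrow> \<Phi> n"
  then have "uae (tp X c) (\<lambda>n. g n dvd k n \<and> \<Phi> (g n))"
    by (intro uae_conjI[OF c] assms(3)) (simp add: codes_uae[OF assms(1)])
  then show "uae (tp X y) \<Phi>" unfolding codes_uae[OF assms(2)]
    by (rule uae_mono[OF c]) (use up codesD(3)[OF assms(2)] in blast)
qed

lemma hpow_hnat: "x \<in> hnat X \<Longrightarrow> y \<in> hnat X \<Longrightarrow> hpow X x y \<in> hnat X"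
  by (rule ex_common_code[of x y]) (blast dest: codesD codes_hpow)+

section \<open>Classes of exponents and the standard function of a class of the first kind\<close>

lemma equiv_pair_equiv: "equiv (pairs X P) (pair_equiv X P)"
  unfolding equiv_def refl_on_def sym_def trans_def pair_equiv_def teq_def
  using tdvd_refl tdvd_trans by blast

lemma exps_subset: "w \<in> exps X P \<Longrightarrow> w \<subseteq> pairs X P"
  unfolding exps_def using equiv_pair_equiv by (metis in_quotient_imp_subset)

lemma exps_eq:
  assumes "v \<in> exps X P" "w \<in> exps X P" "(p, a) \<in> v" "(p, a) \<in> w"
  shows "v = w"
  using quotient_disj[OF equiv_pair_equiv, of v P w] assms unfolding exps_def by blast

lemma mem_exps_iff:
  assumes "w \<in> exps X P" "(p, a) \<in> w"
  shows "(q, b) \<in> w \<longleftrightarrow> generator X q P \<and> b \<in> hnat X \<and> teq (tp X (hpow X p a)) (tp X (hpow X q b))"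
proof -
  have w: "w = pair_equiv X P `` {(p, a)}"
    using assms quotient_eq_iff[OF equiv_pair_equiv] unfolding exps_def
    by (metis (no_types, lifting) Image_singleton_iff equiv_class_eq equiv_pair_equiv quotientE)
  have "(p, a) \<in> pairs X P" using exps_subset assms by blast
  then show ?thesis by (subst w) (auto simp: pair_equiv_def pairs_def)
qed

lemma ex_exps:
  assumes "generator X p P" "a \<in> hnat X"
  shows "\<exists>w\<in>exps X P. (p, a) \<in> w"
proof -
  have "(p, a) \<in> pairs X P" using assms by (simp add: pairs_def)
  then show ?thesis unfolding exps_def
    by (intro bexI[of _ "pair_equiv X P `` {(p, a)}"] quotientI equiv_class_self[OF equiv_pair_equiv])
qed

text \<open>Both types are the image of \<open>P\<close> under the map from \<open>n\<close> to
  \<open>n ^ f n\<close>.\<close>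

lemma tp_hpow_cong:
  assumes "generator X p P" "generator X q P" "codes p a f" "codes q b f"
  shows "tp X (hpow X p a) = tp X (hpow X q b)"
proof -
  have p: "codes p (hpow X p a) (\<lambda>n. n ^ f n)"
    using codes_hpow[OF codes_self assms(3)] codesD(1)[OF assms(3)] .
  have q: "codes q (hpow X q b) (\<lambda>n. n ^ f n)"
    using codes_hpow[OF codes_self assms(4)] codesD(1)[OF assms(4)] .
  show ?thesis
  proof (rule betaN_eqI)
    show "uae (tp X (hpow X q b)) \<Phi>" if "uae (tp X (hpow X p a)) \<Phi>" for \<Phi>
      using that assms(1,2) unfolding codes_uae[OF p] codes_uae[OF q] generator_def by simp
  qed (use tp_betaN codesD(2) p q in blast)+
qed

lemma uae_prime:
  assumes "P \<in> prime_ufs"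
  shows "uae P prime"
proof -
  have "primes = {n \<in> Npos. prime n}" by (auto simp: primes_def Npos_def prime_gt_0_nat)
  then show ?thesis using assms by (simp add: prime_ufs_def uae_def)
qed

lemma betaN_upset_subset:
  assumes "F \<in> betaN" "G \<in> betaN" "\<And>A. A \<in> F \<Longrightarrow> A \<in> upsets \<Longrightarrow> uae G (\<lambda>n. n \<in> A)"
  shows "tdvd F G"
  unfolding tdvd_def using assms(3) uae_mem[OF assms(2)] by (auto simp: upsets_def)

lemma upsets_Int:
  assumes "F \<in> betaN" "A \<in> F" "B \<in> F" "A \<in> upsets" "B \<in> upsets"
  shows "A \<inter> B \<in> upsets"
proof -
  have "A \<inter> B \<noteq> {}" using betaN_Int[OF assms(1-3)] assms(1) by (auto simp: betaN_def)
  moreover have "A = up A" "B = up B" "A \<subseteq> Npos" using assms(4,5) by (auto simp: upsets_def)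
  moreover have "A \<inter> B \<subseteq> up (A \<inter> B)"
  proof
    fix x assume "x \<in> A \<inter> B"
    then show "x \<in> up (A \<inter> B)" using \<open>A \<subseteq> Npos\<close> dvd_refl[of x] unfolding up_def by blast
  qed
  moreover have "up (A \<inter> B) \<subseteq> up A \<inter> up B" by (auto simp: up_def)
  ultimately show ?thesis unfolding upsets_def by blast
qed

text \<open>If \<open>u\<close> has only one exponent \<open>a\<close> at \<open>p\<close>, then by saturation a single upward closed set
  \<open>A\<close> separates \<open>p\<^sup>a\<close> from the smaller powers of \<open>p\<close>; hence \<open>a\<close> is the least exponent with
  \<open>p\<^sup>a\<close> in the extension of \<open>A\<close>, which is a standard function of \<open>p\<close>.\<close>

lemma first_kind_function:
  assumes "first_kind X P u"
  shows "\<exists>f. (\<forall>n>0. 0 < f n) \<and> (\<forall>p a. generator X p P \<longrightarrow> ((p, a) \<in> u \<longleftrightarrow> codes p a f))"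
proof -
  have P: "P \<in> prime_ufs" and u: "u \<in> exps X P"
    and unique: "\<And>p. generator X p P \<Longrightarrow> \<exists>!a. a \<in> hnat X \<and> (p, a) \<in> u"
    using assms unfolding first_kind_def by auto
  have PB: "P \<in> betaN" using P by (simp add: prime_ufs_def)
  obtain p where p: "generator X p P" using ex_generator[OF PB] by blast
  then have ph: "p \<in> hnat X" "tp X p = P" by (auto simp: generator_def)
  obtain a where a: "a \<in> hnat X" "(p, a) \<in> u" using unique[OF p] by blast
  define y where "y = hpow X p a"
  have y: "y \<in> hnat X" unfolding y_def using hpow_hnat ph a by blast
  note T = tp_betaN[OF y]
  define E where "E = tp X y \<inter> upsets"
  \<comment> \<open>Excluding \<open>m = n\<close> makes the exponent of a divisor of a prime power
    smaller; excluding \<open>m = 1\<close> keeps it positive, hence an admissible exponent.\<close>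
  define R where "R A m n \<longleftrightarrow> m \<in> A \<and> m dvd n \<and> m \<noteq> 1 \<and> m \<noteq> n" for A and m n :: nat
  have NE: "Npos \<in> E" using T by (auto simp: E_def betaN_def upsets_def up_def Npos_def)
  \<comment> \<open>Otherwise saturation gives a proper divisor \<open>z\<close> of p^a, different
    from 1, in the extension of every set in \<open>E\<close>. It is a power of \<open>p\<close>
    equivalent to p^a with a smaller exponent, against the uniqueness of \<open>a\<close>.\<close>
  have "\<exists>A\<in>E. \<not> uae (tp X y) (\<lambda>n. \<exists>m>0. R A m n)"
  proof (rule ccontr)
    assume "\<not> ?thesis"
    then have contr: "uae (tp X y) (\<lambda>n. \<exists>m>0. R A m n)" if "A \<in> E" for A using that by blast
    have "\<exists>z\<in>hnat X. \<forall>Q\<in>R ` E. H2 Q z y"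
    proof (rule saturation_directed[OF y])
      show "R ` E \<noteq> {}" using NE by blast
      fix Q Q' assume "Q \<in> R ` E" "Q' \<in> R ` E"
      then obtain A B where AB: "A \<in> E" "B \<in> E" "Q = R A" "Q' = R B" by blast
      then have "A \<inter> B \<in> E" unfolding E_def using betaN_Int[OF T] upsets_Int[OF T] by blast
      then show "\<exists>S\<in>R ` E. \<forall>m n. S m n \<longrightarrow> Q m n \<and> Q' m n"
        using AB by (intro bexI[of _ "R (A \<inter> B)"]) (auto simp: R_def)
    qed (use contr in blast)
    then obtain z where z: "z \<in> hnat X" and zR: "\<And>A. A \<in> E \<Longrightarrow> H2 (R A) z y" by blast
    obtain d j l where d: "codes d p j" "codes d a l" using ex_common_code[OF ph(1) a(1)] .
    obtain c k g2 where c: "codes c d k" "codes c z g2" using ex_common_code[OF codesD(1)[OF d(1)] z] .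
    define g where "g n = j (k n)" for n
    define e where "e n = l (k n)" for n
    have cp: "codes c p g" and ca: "codes c a e"
      unfolding g_def[abs_def] e_def[abs_def] by (rule codes_comp[OF c(1) d(1)], rule codes_comp[OF c(1) d(2)])
    have cy: "codes c y (\<lambda>n. g n ^ e n)" unfolding y_def by (rule codes_hpow[OF cp ca])
    note C = tp_betaN[OF codesD(1)[OF cp]]
    have pr: "uae (tp X c) (\<lambda>n. prime (g n))"
      using uae_prime[OF P] unfolding ph(2)[symmetric] codes_uae[OF cp] .
    have zN: "uae (tp X c) (\<lambda>n. R Npos (g2 n) (g n ^ e n))"
      using zR[OF NE] unfolding codes_H2[OF c(2) cy] .
    define b where "b n = max 1 (multiplicity (g n) (g2 n))" for n
    have "\<exists>b'. codes c b' b" by (rule ex_codes[OF codesD(1)[OF cp]]) (simp add: b_def)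
    then obtain b' where cb: "codes c b' b" by (elim exE)
    have *: "uae (tp X c) (\<lambda>n. prime (g n) \<and> R Npos (g2 n) (g n ^ e n))"
      by (rule uae_conjI[OF C pr zN])
    have gb: "g2 n = g n ^ b n \<and> b n < e n" if "prime (g n) \<and> R Npos (g2 n) (g n ^ e n)" for n
    proof -
      have "g2 n dvd g n ^ e n" "prime (g n)" "g2 n \<noteq> 1" "g2 n \<noteq> g n ^ e n" using that by (auto simp: R_def)
      then obtain i where i: "i \<le> e n" "g2 n = g n ^ i" using divides_primepow_nat by blast
      then have "i \<noteq> 0" "i \<noteq> e n" using \<open>g2 n \<noteq> 1\<close> \<open>g2 n \<noteq> g n ^ e n\<close> by auto
      moreover have "multiplicity (g n) (g2 n) = i" using i \<open>prime (g n)\<close> by (simp add: multiplicity_same_power prime_gt_Suc_0_nat)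
      ultimately show ?thesis using i by (simp add: b_def max_def)
    qed
    have "z = hpow X p b'" unfolding codes_eq[OF c(2) codes_hpow[OF cp cb]]
      by (rule uae_mono[OF C *]) (use gb in blast)
    moreover have "teq (tp X y) (tp X z)" unfolding teq_def
    proof
      show "tdvd (tp X z) (tp X y)"
        by (rule tdvd_tp[OF c(2) cy]) (rule uae_mono[OF C zN], simp add: R_def)
      show "tdvd (tp X y) (tp X z)"
      proof (rule betaN_upset_subset[OF T tp_betaN[OF z]])
        fix A assume "A \<in> tp X y" "A \<in> upsets"
        then have "uae (tp X c) (\<lambda>n. R A (g2 n) (g n ^ e n))"
          using zR[of A] unfolding codes_H2[OF c(2) cy] by (simp add: E_def)
        then show "uae (tp X z) (\<lambda>n. n \<in> A)" unfolding codes_uae[OF c(2)]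
          by (rule uae_mono[OF C]) (simp add: R_def)
      qed
    qed
    ultimately have "(p, b') \<in> u" using mem_exps_iff[OF u a(2), of p b'] p codesD(2)[OF cb] by (simp add: y_def)
    then have "b' = a" using unique[OF p] a codesD(2)[OF cb] by blast
    then have "uae (tp X c) (\<lambda>n. b n = e n)" unfolding codes_eq[OF cb ca] .
    then have "uae (tp X c) (\<lambda>n. b n = e n \<and> prime (g n) \<and> R Npos (g2 n) (g n ^ e n))"
      by (rule uae_conjI[OF C _ *])
    then have "uae (tp X c) (\<lambda>n. False)"
    proof (rule uae_mono[OF C])
      fix n assume "b n = e n \<and> prime (g n) \<and> R Npos (g2 n) (g n ^ e n)"
      then show False using gb[of n] by simp
    qed
    then show False using uae_False[OF C] by blast
  qed
  then obtain A where A: "A \<in> E" "\<not> uae (tp X y) (\<lambda>n. \<exists>m>0. R A m n)" by blast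
  define f where "f q = (if \<exists>i>0. q ^ i \<in> A then LEAST i. 0 < i \<and> q ^ i \<in> A else 1)" for q :: nat
  have fpos: "0 < f q" for q
  proof (cases "\<exists>i>0. q ^ i \<in> A")
    case True
    then show ?thesis using LeastI_ex[of "\<lambda>i. 0 < i \<and> q ^ i \<in> A"] by (simp add: f_def)
  next
    case False
    then have "f q = 1" unfolding f_def by (rule if_not_P)
    then show ?thesis by simp
  qed
  have paf: "codes p a f"
  proof -
    obtain c g e where c: "codes c p g" "codes c a e" using ex_common_code[OF ph(1) a(1)] .
    have cy: "codes c y (\<lambda>n. g n ^ e n)" unfolding y_def by (rule codes_hpow[OF c])
    note C = tp_betaN[OF codesD(1)[OF c(1)]]
    have pr: "uae (tp X c) (\<lambda>n. prime (g n))"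
      using uae_prime[OF P] unfolding ph(2)[symmetric] codes_uae[OF c(1)] .
    have AA: "A \<in> tp X y" "A \<subseteq> Npos" using A(1) by (auto simp: E_def upsets_def)
    have "uae (tp X y) (\<lambda>n. n \<in> A)" using AA uae_mem[OF T] by blast
    then have mem: "uae (tp X c) (\<lambda>n. g n ^ e n \<in> A)" unfolding codes_uae[OF cy] .
    have no: "uae (tp X c) (\<lambda>n. \<not> (\<exists>m>0. R A m (g n ^ e n)))"
      using A(2) unfolding uae_not[OF C] codes_uae[OF cy] .
    have eq: "uae (tp X c) (\<lambda>n. e n = f (g n))"
      using uae_conjI[OF C pr uae_conjI[OF C mem no]]
    proof (rule uae_mono[OF C])
      fix n :: nat assume n: "0 < n" "prime (g n) \<and> g n ^ e n \<in> A \<and> \<not> (\<exists>m>0. R A m (g n ^ e n))"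
      have e: "0 < e n" using codesD(3)[OF c(2)] n by blast
      have "(LEAST i. 0 < i \<and> g n ^ i \<in> A) = e n"
      proof (rule Least_equality)
        fix i assume i: "0 < i \<and> g n ^ i \<in> A"
        show "e n \<le> i"
        proof (rule ccontr)
          assume "\<not> e n \<le> i"
          then have "g n ^ i dvd g n ^ e n" by (simp add: le_imp_power_dvd)
          moreover have "g n ^ i \<noteq> g n ^ e n" "g n ^ i \<noteq> 1" "0 < g n ^ i"
            using n(2) i \<open>\<not> e n \<le> i\<close> prime_gt_1_nat[of "g n"] by (auto simp: power_inject_exp)
          ultimately show False using n(2) i by (auto simp: R_def)
        qed
      qed (use n e in simp)
      moreover have "\<exists>i>0. g n ^ i \<in> A" using n e by blast
      ultimately show "e n = f (g n)" unfolding f_def by simp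
    qed
    have "\<exists>a'. codes p a' f" by (rule ex_codes[OF ph(1)]) (rule fpos)
    then obtain a' where a': "codes p a' f" by (elim exE)
    have "a = a'" unfolding codes_eq[OF c(2) codes_comp[OF c(1) a']] by (rule eq)
    then show ?thesis using a' by simp
  qed
  show ?thesis
  proof (intro exI[of _ f] conjI allI impI)
    show "(q, b) \<in> u \<longleftrightarrow> codes q b f" if q: "generator X q P" for q b
    proof -
      have qh: "q \<in> hnat X" using q by (simp add: generator_def)
      have "\<exists>b'. codes q b' f" by (rule ex_codes[OF qh]) (rule fpos)
      then obtain b' where b': "codes q b' f" by (elim exE)
      have "(q, b') \<in> u" using mem_exps_iff[OF u a(2), of q b'] q codesD(2)[OF b']
        tp_hpow_cong[OF p q paf b'] by (simp add: teq_def tdvd_refl)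
      moreover have "b \<in> hnat X" if "(q, b) \<in> u" using exps_subset[OF u] that by (auto simp: pairs_def)
      ultimately have "(q, b) \<in> u \<longleftrightarrow> b = b'" using unique[OF q] codesD(2)[OF b'] by blast
      moreover have "b = b'" if "codes q b f"
        unfolding codes_eq[OF that b'] by (rule uae_all[OF tp_betaN[OF qh]]) simp
      ultimately show ?thesis using b' by blast
    qed
  qed (rule fpos)
qed

section \<open>The successor of a class of the first kind\<close>

lemma obtain_code:
  assumes "c \<in> hnat X" "\<And>n. 0 < n \<Longrightarrow> 0 < g n"
  obtains x where "codes c x g"
proof -
  have "\<exists>x. codes c x g" by (rule ex_codes) (fact assms)+
  then show thesis using that by (elim exE)
qed

lemma ex_common_code3:
  assumes "x \<in> hnat X" "y \<in> hnat X" "z \<in> hnat X"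
  obtains c g k l where "codes c x g" "codes c y k" "codes c z l"
proof -
  obtain d i j where d: "codes d x i" "codes d y j" using ex_common_code[OF assms(1,2)] .
  obtain c k l where c: "codes c d k" "codes c z l" using ex_common_code[OF codesD(1)[OF d(1)] assms(3)] .
  show thesis by (rule that[OF codes_comp[OF c(1) d(1)] codes_comp[OF c(1) d(2)] c(2)])
qed

lemma tdvd_hpow:
  assumes "p \<in> hnat X" "a \<in> hnat X" "b \<in> hnat X" "hless X a b"
  shows "tdvd (tp X (hpow X p a)) (tp X (hpow X p b))"
proof -
  obtain c g k l where c: "codes c p g" "codes c a k" "codes c b l" using ex_common_code3[OF assms(1-3)] .
  show ?thesis
    by (rule tdvd_tp[OF codes_hpow[OF c(1,2)] codes_hpow[OF c(1,3)]],
        rule uae_mono[OF tp_betaN[OF codesD(1)[OF c(1)]]], rule assms(4)[unfolded hless_iff[OF c(2,3)]])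
      (simp add: le_imp_power_dvd)
qed

text \<open>A larger exponent gives a multiple. Witnesses for both directions, possibly at different
  generators \<open>p\<close> and \<open>q\<close>, thus make all four types equivalent, and
  \<open>v\<close> and \<open>w\<close> would share a pair.\<close>

lemma exp_less_antisym:
  assumes v: "v \<in> exps X P" and w: "w \<in> exps X P" and "exp_less X P v w"
  shows "\<not> exp_less X P w v"
proof
  assume "exp_less X P w v"
  then obtain q b' a' where q: "generator X q P" "b' \<in> hnat X" "a' \<in> hnat X" "hless X b' a'" "(q, b') \<in> w" "(q, a') \<in> v"
    unfolding exp_less_def by blast
  obtain p a b where p: "generator X p P" "a \<in> hnat X" "b \<in> hnat X" "hless X a b" "(p, a) \<in> v" "(p, b) \<in> w"
    and ne: "v \<noteq> w" using assms(3) unfolding exp_less_def by blast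
  have "tdvd (tp X (hpow X p a)) (tp X (hpow X p b))" "tdvd (tp X (hpow X q b')) (tp X (hpow X q a'))"
    using tdvd_hpow p q unfolding generator_def by blast+
  moreover have "teq (tp X (hpow X p a)) (tp X (hpow X q a'))" "teq (tp X (hpow X p b)) (tp X (hpow X q b'))"
    using mem_exps_iff[OF v p(5)] mem_exps_iff[OF w p(6)] q by blast+
  ultimately have "teq (tp X (hpow X p a)) (tp X (hpow X p b))"
    unfolding teq_def using tdvd_trans by blast
  then have "(p, b) \<in> v" using mem_exps_iff[OF v p(5)] p by blast
  then show False using exps_eq[OF v w _ p(6)] ne by blast
qed

text \<open>The candidate \<open>v\<close> is the class of p^(f(p) + 1) for one generator
  \<open>p\<close>; by \<open>tp_hpow_cong\<close> it contains the corresponding pair at every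
  generator. A class above \<open>u\<close> is witnessed at some generator \<open>q\<close> by an
  exponent larger than f(q), hence at least f(q) + 1, so it is not below \<open>v\<close>.\<close>

lemma exp_succ_first_kind:
  assumes P: "P \<in> betaN" and u: "u \<in> exps X P"
    and f: "\<And>n. 0 < n \<Longrightarrow> 0 < f n" "\<And>p a. generator X p P \<Longrightarrow> (p, a) \<in> u \<longleftrightarrow> codes p a f"
  shows "exp_succ X P u \<in> exps X P"
    and "\<And>p b. generator X p P \<Longrightarrow> codes p b (\<lambda>n. Suc (f n)) \<Longrightarrow> (p, b) \<in> exp_succ X P u"
proof -
  obtain p where p: "generator X p P" using ex_generator[OF P] by blast
  then have ph: "p \<in> hnat X" by (simp add: generator_def)
  note T = tp_betaN[OF ph]
  obtain a where a: "codes p a f" by (rule obtain_code[where g=f, OF ph f(1)])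
  obtain b where b: "codes p b (\<lambda>n. Suc (f n))" by (rule obtain_code[where g="\<lambda>n. Suc (f n)", OF ph zero_less_Suc])
  obtain v where v: "v \<in> exps X P" "(p, b) \<in> v" using ex_exps[OF p codesD(2)[OF b]] by blast
  have mem_v: "(q, c) \<in> v" if "generator X q P" "codes q c (\<lambda>n. Suc (f n))" for q c
    using mem_exps_iff[OF v, of q c] that tp_hpow_cong[OF p that(1) b that(2)] codesD(2)[OF that(2)]
    by (simp add: teq_def tdvd_refl)
  have "v \<noteq> u"
  proof
    assume "v = u"
    then have b': "codes p b f" using f(2)[OF p] v by blast
    have "uae (tp X p) (\<lambda>n. Suc (f n) = f n)" using codes_eq[OF b b'] by (simp only: refl)
    then show False using uae_False[OF T] by simp
  qed
  moreover have "hless X a b" unfolding hless_iff[OF a b] by (rule uae_all[OF T]) simp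
  ultimately have uv: "exp_less X P u v"
    using p codesD(2)[OF a] codesD(2)[OF b] f(2)[OF p] a v(2) unfolding exp_less_def by blast
  have least: "exp_le X P v w" if w: "w \<in> exps X P" and uw: "exp_less X P u w" for w
  proof -
    obtain q a' b' where q: "generator X q P" "a' \<in> hnat X" "b' \<in> hnat X" "hless X a' b'" "(q, a') \<in> u" "(q, b') \<in> w"
      using uw unfolding exp_less_def by blast
    have qh: "q \<in> hnat X" using q by (simp add: generator_def)
    obtain d where d: "codes q d (\<lambda>n. Suc (f n))" by (rule obtain_code[where g="\<lambda>n. Suc (f n)", OF qh zero_less_Suc])
    have a': "codes q a' f" using f(2) q by blast
    obtain c g k where c: "codes c q g" "codes c b' k" using ex_common_code[OF qh q(3)] .
    note C = tp_betaN[OF codesD(1)[OF c(1)]]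
    note cd = codes_comp[OF c(1) d]
    have less: "uae (tp X c) (\<lambda>n. f (g n) < k n)" using q(4) unfolding hless_iff[OF codes_comp[OF c(1) a'] c(2)] .
    show ?thesis
    proof (cases "b' = d")
      case True
      then have "v = w" using exps_eq[OF v(1) w, of q b'] mem_v[OF q(1) d] q(6) by blast
      then show ?thesis by (simp add: exp_le_def)
    next
      case False
      then have "uae (tp X c) (\<lambda>n. \<not> (k n = Suc (f (g n))))"
        unfolding codes_eq[OF c(2) cd] uae_not[OF C] .
      from uae_conjI[OF C less this] have "uae (tp X c) (\<lambda>n. Suc (f (g n)) < k n)"
        by (rule uae_mono[OF C]) auto
      then have "hless X d b'" unfolding hless_iff[OF cd c(2)] .
      then show ?thesis using q mem_v[OF q(1) d] codesD(2)[OF d] unfolding exp_le_def exp_less_def by blast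
    qed
  qed
  have "exp_succ X P u = v" unfolding exp_succ_def
  proof (rule the_equality)
    show "v \<in> exps X P \<and> exp_less X P u v \<and> (\<forall>w\<in>exps X P. exp_less X P u w \<longrightarrow> exp_le X P v w)"
      using v uv least by blast
    fix w assume w: "w \<in> exps X P \<and> exp_less X P u w \<and> (\<forall>w'\<in>exps X P. exp_less X P u w' \<longrightarrow> exp_le X P w w')"
    then have "exp_le X P w v" "exp_le X P v w" using v uv least by blast+
    then show "w = v" using exp_less_antisym[OF v(1), of w] w unfolding exp_le_def by blast
  qed
  then show "exp_succ X P u \<in> exps X P"
    "\<And>p b. generator X p P \<Longrightarrow> codes p b (\<lambda>n. Suc (f n)) \<Longrightarrow> (p, b) \<in> exp_succ X P u"
    using v mem_v by simp_all
qed

text \<open>A prime power determines its prime, so the type of \<open>p\<^sup>b\<close> determines the type of \<open>p\<close>.\<close>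

lemma tp_hpow_prime:
  assumes "p \<in> hnat X" "tp X p \<in> prime_ufs" "q \<in> hnat X" "tp X q \<in> prime_ufs" "a \<in> hnat X" "b \<in> hnat X"
    and eq: "tp X (hpow X p a) = tp X (hpow X q b)"
  shows "tp X p = tp X q"
proof (rule betaN_eqI)
  fix \<Phi> assume \<Phi>: "uae (tp X p) \<Phi>"
  let ?\<Psi> = "\<lambda>n. \<forall>r. prime r \<longrightarrow> r dvd n \<longrightarrow> \<Phi> r"
  obtain c g k where c: "codes c p g" "codes c a k" using ex_common_code[OF assms(1,5)] .
  note C = tp_betaN[OF codesD(1)[OF c(1)]]
  have "uae (tp X c) (\<lambda>n. prime (g n) \<and> \<Phi> (g n))"
    using uae_conjI[OF tp_betaN[OF assms(1)] uae_prime[OF assms(2)] \<Phi>] unfolding codes_uae[OF c(1)] .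
  then have "uae (tp X (hpow X p a)) ?\<Psi>" unfolding codes_uae[OF codes_hpow[OF c]]
    by (rule uae_mono[OF C]) (metis prime_dvd_power primes_dvd_imp_eq)
  then have \<Psi>: "uae (tp X (hpow X q b)) ?\<Psi>" unfolding eq .
  obtain d h l where d: "codes d q h" "codes d b l" using ex_common_code[OF assms(3,6)] .
  note D = tp_betaN[OF codesD(1)[OF d(1)]]
  have pr: "uae (tp X d) (\<lambda>n. prime (h n))" using uae_prime[OF assms(4)] unfolding codes_uae[OF d(1)] .
  have "uae (tp X d) (\<lambda>n. prime (h n) \<and> ?\<Psi> (h n ^ l n))"
    by (rule uae_conjI[OF D pr]) (rule \<Psi>[unfolded codes_uae[OF codes_hpow[OF d]]])
  then show "uae (tp X q) \<Phi>" unfolding codes_uae[OF d(1)]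
  proof (rule uae_mono[OF D])
    fix n :: nat assume n: "0 < n" "prime (h n) \<and> ?\<Psi> (h n ^ l n)"
    have "h n dvd h n ^ l n" using codesD(3)[OF d(2) n(1)] by (simp add: dvd_power)
    then show "\<Phi> (h n)" using n by blast
  qed
qed (use assms tp_betaN in blast)+

text \<open>Two gaps are closed. A basic class is just a set of ultrafilters, so
  \<open>tp_hpow_prime\<close> must first recover that \<open>p\<close> generates \<open>P\<close>.
  Then equivalence of p^b with p^(f(p) + 1) must give equal exponents: divisibility by r^(i + f(r))
  for some prime r is upward closed, and for a power of a prime q and positive i it says that the
  exponent is at least i + f(q). The cases i = 1 and i = 2 leave only f(q) + 1.\<close>

lemma pattern_exp_succ:
  assumes P: "P \<in> prime_ufs" and v: "v \<in> exps X P"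
    and mem_v: "\<And>p b. generator X p P \<Longrightarrow> codes p b (\<lambda>n. Suc (f n)) \<Longrightarrow> (p, b) \<in> v"
    and pos: "pattern X x (basic_class X v) > 0"
  obtains p b where "generator X p P" "codes p b (\<lambda>n. Suc (f n))" "exact_dvd X p b x"
proof -
  have "{(p, a). generates_basic X p a (basic_class X v) \<and> exact_dvd X p a x} \<noteq> {}"
  proof
    assume "{(p, a). generates_basic X p a (basic_class X v) \<and> exact_dvd X p a x} = {}"
    then have "pattern X x (basic_class X v) = 0"
      unfolding pattern_def by (simp only: ecard_def finite.emptyI card.empty if_True zero_enat_def)
    then show False using pos by simp
  qed
  then obtain p b where pb: "generates_basic X p b (basic_class X v)" "exact_dvd X p b x" by blast
  obtain P' u' where u': "P' \<in> prime_ufs" "u' \<in> exps X P'" "basic_class X v = basic_class X u'" "(p, b) \<in> u'"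
    using pb(1) unfolding generates_basic_def by blast
  have p': "generator X p P'" "b \<in> hnat X" using exps_subset[OF u'(2)] u'(4) by (auto simp: pairs_def)
  have "tp X (hpow X p b) \<in> basic_class X v"
    unfolding u'(3) unfolding basic_class_def by (rule CollectI, rule exI[of _ p], rule exI[of _ b], rule conjI[OF refl u'(4)])
  then obtain q d where qd: "(q, d) \<in> v" "tp X (hpow X p b) = tp X (hpow X q d)"
    unfolding basic_class_def by (elim CollectE exE conjE)
  have q: "generator X q P" "d \<in> hnat X" using exps_subset[OF v] qd(1) by (auto simp: pairs_def)
  have ph: "p \<in> hnat X" using p' by (simp add: generator_def)
  have "tp X p = tp X q"
    using p'(1) q(1) u'(1) P by (intro tp_hpow_prime[OF _ _ _ _ p'(2) q(2) qd(2)]) (simp_all add: generator_def)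
  then have p: "generator X p P" using q ph by (simp add: generator_def)
  have Tp: "uae (tp X p) prime" using p uae_prime[OF P] by (simp add: generator_def)
  obtain b0 where b0: "codes p b0 (\<lambda>n. Suc (f n))" by (rule obtain_code[where g="\<lambda>n. Suc (f n)", OF ph zero_less_Suc])
  have d: "tdvd (tp X (hpow X p b0)) (tp X (hpow X p b))" "tdvd (tp X (hpow X p b)) (tp X (hpow X p b0))"
    using mem_exps_iff[OF v mem_v[OF p b0], of q d] qd by (simp_all add: teq_def)
  obtain c g k where c: "codes c p g" "codes c b k" using ex_common_code[OF ph p'(2)] .
  note C = tp_betaN[OF codesD(1)[OF c(1)]]
  note cb0 = codes_comp[OF c(1) b0]
  have pr: "uae (tp X c) (\<lambda>n. prime (g n))" using Tp unfolding codes_uae[OF c(1)] .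
  have B: "tp X (hpow X p b0) \<in> betaN" "tp X (hpow X p b) \<in> betaN"
    using tp_betaN hpow_hnat ph p'(2) codesD(2)[OF b0] by blast+
  have up: "\<exists>r. prime r \<and> r ^ (i + f r) dvd n" if "m dvd n" "\<exists>r. prime r \<and> r ^ (i + f r) dvd m" for m n i :: nat
    using that dvd_trans by blast
  have pow: "(\<exists>r. prime r \<and> r ^ (i + f r) dvd q ^ j) \<longleftrightarrow> i + f q \<le> j" if "prime q" "0 < i" for q i j :: nat
  proof
    assume "\<exists>r. prime r \<and> r ^ (i + f r) dvd q ^ j"
    then obtain r where r: "prime r" "r ^ (i + f r) dvd q ^ j" by blast
    have "r dvd r ^ (i + f r)" using that by (intro dvd_power) auto
    then have "r dvd q ^ j" using r dvd_trans by blast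
    then have "r = q" using r that by (metis prime_dvd_power primes_dvd_imp_eq)
    then show "i + f q \<le> j" using r that prime_gt_1_nat[OF that(1)] by (simp add: power_dvd_imp_le)
  next
    assume "i + f q \<le> j"
    then show "\<exists>r. prime r \<and> r ^ (i + f r) dvd q ^ j" using that le_imp_power_dvd by blast
  qed
  let ?\<Phi> = "\<lambda>i n. \<exists>r. prime r \<and> r ^ (i + f r) dvd n"
  have ge: "uae (tp X c) (\<lambda>n. ?\<Phi> 1 (g n ^ k n))"
  proof -
    have "uae (tp X (hpow X p b0)) (?\<Phi> 1)" unfolding codes_uae[OF codes_hpow[OF c(1) cb0]]
      by (rule uae_mono[OF C pr], rule_tac x = "g n" in exI) simp
    then have "uae (tp X (hpow X p b)) (?\<Phi> 1)"
      by (rule tdvd_upward[OF B d(1)]) (rule up)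
    then show ?thesis unfolding codes_uae[OF codes_hpow[OF c]] .
  qed
  have le: "uae (tp X c) (\<lambda>n. \<not> ?\<Phi> 2 (g n ^ k n))"
    unfolding uae_not[OF C]
  proof
    assume "uae (tp X c) (\<lambda>n. ?\<Phi> 2 (g n ^ k n))"
    then have "uae (tp X (hpow X p b)) (?\<Phi> 2)" unfolding codes_uae[OF codes_hpow[OF c]] .
    then have "uae (tp X (hpow X p b0)) (?\<Phi> 2)"
      by (rule tdvd_upward[OF B(2,1) d(2)]) (rule up)
    then have "uae (tp X c) (\<lambda>n. ?\<Phi> 2 (g n ^ Suc (f (g n))))" unfolding codes_uae[OF codes_hpow[OF c(1) cb0]] .
    from uae_conjI[OF C pr this] have "uae (tp X c) (\<lambda>n. False)"
    proof (rule uae_mono[OF C])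
      fix n assume n: "prime (g n) \<and> ?\<Phi> 2 (g n ^ Suc (f (g n)))"
      then show False using pow[of "g n" 2 "Suc (f (g n))"] by simp
    qed
    then show False using uae_False[OF C] by blast
  qed
  have "b = b0" unfolding codes_eq[OF c(2) cb0]
    using uae_conjI[OF C pr uae_conjI[OF C ge le]]
  proof (rule uae_mono[OF C])
    fix n assume n: "prime (g n) \<and> ?\<Phi> 1 (g n ^ k n) \<and> \<not> ?\<Phi> 2 (g n ^ k n)"
    then have "1 + f (g n) \<le> k n" "\<not> 2 + f (g n) \<le> k n"
      using pow[of "g n" 1 "k n", OF _ zero_less_one] pow[of "g n" 2 "k n", OF _ zero_less_numeral] by blast+
    then show "k n = Suc (f (g n))" by simp
  qed
  then show thesis using that[OF p] b0 pb(2) by blast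
qed

text \<open>The exponent \<open>b\<close> is the value of the multiplicity of \<open>q\<close> in
  \<open>x\<close>; it is at least f(q), which is positive. Each \<open>max 1\<close> in the codes
  only provides positive values outside the almost sure set.\<close>

lemma ex_exact_dvd:
  assumes P: "P \<in> prime_ufs" and q: "generator X q P" and c: "codes q c f" and x: "x \<in> hnat X"
    and dvd: "hdvd X (hpow X q c) x"
  obtains b where "b \<in> hnat X" "exact_dvd X q b x" "b = c \<or> hless X c b"
proof -
  have qh: "q \<in> hnat X" "tp X q = P" using q by (auto simp: generator_def)
  obtain d g l where d: "codes d q g" "codes d x l" using ex_common_code[OF qh(1) x] .
  note D = tp_betaN[OF codesD(1)[OF d(1)]]
  have dh: "d \<in> hnat X" by (rule codesD(1)[OF d(1)])
  note dc = codes_comp[OF d(1) c]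
  have pr: "uae (tp X d) (\<lambda>n. prime (g n))" using uae_prime[OF P] unfolding qh(2)[symmetric] codes_uae[OF d(1)] .
  have dv: "uae (tp X d) (\<lambda>n. g n ^ f (g n) dvd l n)"
    using dvd unfolding hdvd_iff[OF codes_hpow[OF d(1) dc] d(2)] .
  note pd = uae_conjI[OF D pr dv]
  define m where "m n = multiplicity (g n) (l n)" for n
  have m: "f (g n) \<le> m n" "0 < m n" "l n = g n ^ m n * (l n div g n ^ m n)" "0 < l n div g n ^ m n"
      "\<not> g n dvd l n div g n ^ m n" if "0 < n" "prime (g n) \<and> g n ^ f (g n) dvd l n" for n
  proof -
    have l: "l n \<noteq> 0" "0 < f (g n)" using codesD(3)[OF d(2) that(1)] codesD(3)[OF dc that(1)] by auto
    have p: "\<not> is_unit (g n)" using that(2) by (auto dest: not_prime_unit)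
    show "f (g n) \<le> m n" unfolding m_def using that(2) l p by (intro multiplicity_geI) auto
    then show "0 < m n" using l by simp
    show *: "l n = g n ^ m n * (l n div g n ^ m n)" by (simp add: m_def multiplicity_dvd)
    show "\<not> g n dvd l n div g n ^ m n" unfolding m_def by (rule multiplicity_decompose[OF l(1) p])
    show "0 < l n div g n ^ m n"
    proof (rule ccontr)
      assume "\<not> ?thesis"
      then have "l n = 0" using * by simp
      then show False using l by simp
    qed
  qed
  obtain b where b: "codes d b (\<lambda>n. max 1 (m n))"
    by (rule obtain_code[where g = "\<lambda>n. max 1 (m n)", OF dh]) simp_all
  obtain x' where x': "codes d x' (\<lambda>n. max 1 (l n div g n ^ m n))"
    by (rule obtain_code[where g = "\<lambda>n. max 1 (l n div g n ^ m n)", OF dh]) simp_all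
  have "hin X q primes"
    using pr by (subst codes_hin[OF d(1)]) (auto simp: primes_def Npos_def prime_gt_0_nat)
  moreover have "x = hmult X (hpow X q b) x'"
    unfolding codes_eq[OF d(2) codes_hmult[OF codes_hpow[OF d(1) b] x']]
  proof (rule uae_mono[OF D pd])
    fix n assume "0 < n" "prime (g n) \<and> g n ^ f (g n) dvd l n"
    note m[OF this]
    then show "l n = g n ^ max 1 (m n) * max 1 (l n div g n ^ m n)" by (simp add: max_def)
  qed
  moreover have "uae (tp X d) (\<lambda>n. \<not> g n dvd max 1 (l n div g n ^ m n))"
  proof (rule uae_mono[OF D pd])
    fix n assume "0 < n" "prime (g n) \<and> g n ^ f (g n) dvd l n"
    note m[OF this]
    then show "\<not> g n dvd max 1 (l n div g n ^ m n)" by (simp add: max_def)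
  qed
  then have "\<not> hdvd X q x'" unfolding hdvd_iff[OF d(1) x'] uae_not[OF D] .
  ultimately have "exact_dvd X q b x"
    unfolding exact_dvd_def using codesD(2)[OF b] codesD(2)[OF x'] by blast
  moreover have "uae (tp X d) (\<lambda>n. max 1 (m n) = f (g n) \<or> f (g n) < max 1 (m n))"
  proof (rule uae_mono[OF D pd])
    fix n assume "0 < n" "prime (g n) \<and> g n ^ f (g n) dvd l n"
    note m(1,2)[OF this]
    then show "max 1 (m n) = f (g n) \<or> f (g n) < max 1 (m n)" by (simp add: max_def) linarith
  qed
  then have "b = c \<or> hless X c b"
    unfolding codes_eq[OF b dc] hless_iff[OF dc b] uae_disj[OF D] .
  ultimately show thesis using that codesD(2)[OF b] by blast
qed

section \<open>Counting primes with the pattern\<close>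

lemma ecard_mono: "finite A \<Longrightarrow> A \<subseteq> B \<Longrightarrow> enat (card A) \<le> ecard B"
  by (simp add: ecard_def card_mono)

text \<open>Each \<open>q\<close> in \<open>S\<close> divides \<open>x\<close> to an exact power q^b
  whose class is at least \<open>u\<close>. Sorting \<open>S\<close> by these classes, distinct
  primes give distinct pairs in the set that the pattern counts, so each fibre is at most one
  summand of \<open>esum\<close>.\<close>

lemma card_bounded_of_esum:
  assumes P: "P \<in> prime_ufs" and u: "u \<in> exps X P"
    and f: "\<And>p a. generator X p P \<Longrightarrow> (p, a) \<in> u \<longleftrightarrow> codes p a f" and x: "x \<in> hnat X"
    and fin: "esum (\<lambda>w. pattern X x (basic_class X w)) {w \<in> exps X P. exp_le X P u w} < \<infinity>"
  shows "\<exists>N. \<forall>S. finite S \<longrightarrow>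
    (\<forall>q\<in>S. generator X q P \<and> (\<exists>c. codes q c f \<and> hdvd X (hpow X q c) x)) \<longrightarrow> card S \<le> N"
proof -
  let ?p = "\<lambda>w. pattern X x (basic_class X w)" and ?W = "{w \<in> exps X P. exp_le X P u w}"
  obtain N where N: "esum ?p ?W = enat N" using fin by (cases "esum ?p ?W") auto
  show ?thesis
  proof (intro exI[of _ N] allI impI)
    fix S assume S: "finite S"
      and gen: "\<forall>q\<in>S. generator X q P \<and> (\<exists>c. codes q c f \<and> hdvd X (hpow X q c) x)"
    have "\<exists>b w. w \<in> ?W \<and> (q, b) \<in> w \<and> exact_dvd X q b x" if qS: "q \<in> S" for q
    proof -
      obtain c where q: "generator X q P" "codes q c f" "hdvd X (hpow X q c) x" using gen qS by blast
      obtain b where b: "b \<in> hnat X" "exact_dvd X q b x" "b = c \<or> hless X c b"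
        using ex_exact_dvd[OF P q(1,2) x q(3)] .
      obtain w where w: "w \<in> exps X P" "(q, b) \<in> w" using ex_exps[OF q(1) b(1)] by blast
      have c: "(q, c) \<in> u" "c \<in> hnat X" using f[OF q(1)] q(2) codesD(2) by blast+
      have "exp_le X P u w"
      proof (cases "u = w")
        case False
        then have "b \<noteq> c" using exps_eq[OF u w(1) c(1)] w(2) by blast
        then show ?thesis using False b c q(1) w(2) unfolding exp_le_def exp_less_def by blast
      qed (simp add: exp_le_def)
      then show ?thesis using w b by blast
    qed
    then obtain b w where bw: "\<And>q. q \<in> S \<Longrightarrow> w q \<in> ?W \<and> (q, b q) \<in> w q \<and> exact_dvd X q (b q) x"
      by metis
    have fib: "enat (card {q \<in> S. w q = v}) \<le> ?p v" if "v \<in> w ` S" for v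
    proof -
      have "card {q \<in> S. w q = v} = card ((\<lambda>q. (q, b q)) ` {q \<in> S. w q = v})"
        by (rule card_image[symmetric]) (auto simp: inj_on_def)
      moreover have "enat (card ((\<lambda>q. (q, b q)) ` {q \<in> S. w q = v})) \<le> ?p v"
        unfolding pattern_def
      proof (rule ecard_mono)
        show "(\<lambda>q. (q, b q)) ` {q \<in> S. w q = v}
            \<subseteq> {(p, a). generates_basic X p a (basic_class X v) \<and> exact_dvd X p a x}"
        proof clarify
          fix q assume q: "q \<in> S" "v = w q"
          then have "w q \<in> exps X P" "(q, b q) \<in> w q" "exact_dvd X q (b q) x" using bw by blast+
          then show "generates_basic X q (b q) (basic_class X (w q)) \<and> exact_dvd X q (b q) x"
            unfolding generates_basic_def using P by blast
        qed
      qed (use S in simp)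
      ultimately show ?thesis by simp
    qed
    have "card S = (\<Sum>v\<in>w ` S. card {q \<in> S. w q = v})"
      using sum.image_gen[OF S, of "\<lambda>_. 1::nat" w] by simp
    then have "enat (card S) = (\<Sum>v\<in>w ` S. enat (card {q \<in> S. w q = v}))"
      by (simp flip: of_nat_eq_enat)
    also have "\<dots> \<le> (\<Sum>v\<in>w ` S. ?p v)" by (rule sum_mono) (rule fib)
    also have "\<dots> \<le> esum ?p ?W" unfolding esum_def
      by (rule SUP_upper) (use S bw in auto)
    finally show "card S \<le> N" by (simp add: N)
  qed
qed

end

text \<open>The standard approximation to the generators q of \<open>P\<close> with q^f(q) | x:
  generating \<open>P\<close> is weakened to lying in one set \<open>Q\<close>, and primality is
  demanded separately because \<open>Q\<close> may contain other numbers.\<close>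

definition prime_support :: "(nat \<Rightarrow> nat) \<Rightarrow> nat set \<Rightarrow> nat \<Rightarrow> nat set" where
  "prime_support f Q n = {q \<in> Q. prime q \<and> q ^ f q dvd n}"

lemma finite_prime_support:
  assumes "\<And>q. 0 < q \<Longrightarrow> 0 < f q" "0 < n"
  shows "finite (prime_support f Q n)"
proof (rule finite_subset)
  show "prime_support f Q n \<subseteq> {q. q dvd n}"
  proof
    fix q assume "q \<in> prime_support f Q n"
    then have "prime q" "q ^ f q dvd n" by (auto simp: prime_support_def)
    moreover have "q dvd q ^ f q" using assms(1)[of q] prime_gt_0_nat[OF \<open>prime q\<close>] by (intro dvd_power) auto
    ultimately show "q \<in> {q. q dvd n}" using dvd_trans by blast
  qed
  show "finite {q. q dvd n}" using assms(2) by simp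
qed

lemma prime_support_mono: "m dvd n \<Longrightarrow> prime_support f Q m \<subseteq> prime_support f Q n"
  unfolding prime_support_def using dvd_trans by blast

context saturated_extension
begin

text \<open>A list of \<open>k\<close> distinct primes is coded by one number, so saturation over
  all \<open>Q\<close> in \<open>P\<close> yields a single code \<open>z\<close> whose entries lie
  in the extension of every \<open>Q\<close>. As \<open>k\<close> is a standard number, the entries
  are \<open>k\<close> values of standard functions, and lying in every \<open>Q\<close> makes each
  of them a generator of \<open>P\<close>.\<close>

lemma ex_generators_of_large_support:
  assumes P: "P \<in> prime_ufs" and x: "x \<in> hnat X" and f: "\<And>q. 0 < q \<Longrightarrow> 0 < f q"
    and large: "\<And>Q. Q \<in> P \<Longrightarrow> uae (tp X x) (\<lambda>n. k \<le> card (prime_support f Q n))"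
  shows "\<exists>S. finite S \<and> card S = k \<and> (\<forall>q\<in>S. generator X q P \<and> (\<exists>c. codes q c f \<and> hdvd X (hpow X q c) x))"
proof -
  note T = tp_betaN[OF x]
  have PB: "P \<in> betaN" using P by (simp add: prime_ufs_def)
  define dec where "dec m = list_decode (m - 1)" for m
  define R where "R Q m n \<longleftrightarrow> distinct (dec m) \<and> length (dec m) = k \<and> set (dec m) \<subseteq> prime_support f Q n" for Q m n
  have NP: "Npos \<in> P" using PB by (simp add: betaN_def)
  have "\<exists>z\<in>hnat X. \<forall>S\<in>R ` P. H2 S z x"
  proof (rule saturation_directed[OF x])
    show "R ` P \<noteq> {}" using NP by blast
    fix S S' assume "S \<in> R ` P" "S' \<in> R ` P"
    then obtain A B where AB: "A \<in> P" "B \<in> P" "S = R A" "S' = R B" by blast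
    have "R (A \<inter> B) \<in> R ` P" using betaN_Int[OF PB AB(1,2)] by (rule imageI)
    then show "\<exists>S''\<in>R ` P. \<forall>m n. S'' m n \<longrightarrow> S m n \<and> S' m n"
      unfolding AB(3,4) by (rule rev_bexI) (auto simp: R_def prime_support_def)
  next
    fix S assume "S \<in> R ` P"
    then obtain A where A: "A \<in> P" "S = R A" by blast
    show "uae (tp X x) (\<lambda>n. \<exists>m>0. S m n)" unfolding A(2)
    proof (rule uae_mono[OF T large[OF A(1)]])
      fix n assume "k \<le> card (prime_support f A n)"
      then obtain K where K: "K \<subseteq> prime_support f A n" "card K = k" "finite K"
        by (rule obtain_subset_with_card_n)
      obtain xs where "set xs = K" "distinct xs" using finite_distinct_list[OF K(3)] by blast
      then show "\<exists>m>0. R A m n" using K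
        by (intro exI[of _ "Suc (list_encode xs)"]) (auto simp: R_def dec_def distinct_card)
    qed
  qed
  then obtain z where z: "z \<in> hnat X" "\<And>Q. Q \<in> P \<Longrightarrow> H2 (R Q) z x" by blast
  obtain d l g where d: "codes d z l" "codes d x g" using ex_common_code[OF z(1) x] .
  have dh: "d \<in> hnat X" by (rule codesD(1)[OF d(1)])
  note D = tp_betaN[OF dh]
  have R: "uae (tp X d) (\<lambda>n. R Q (l n) (g n))" if "Q \<in> P" for Q
    using z(2)[OF that] unfolding codes_H2[OF d] .
  define t where "t i n = max 1 (dec (l n) ! i)" for i n
  have "\<exists>y. codes d y (t i)" for i by (rule ex_codes[OF dh]) (simp add: t_def)
  then obtain y where y: "\<And>i. codes d (y i) (t i)" by metis
  have ti: "t i n = dec (l n) ! i" "t i n \<in> prime_support f Q (g n)" if "R Q (l n) (g n)" "i < k" for i n Q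
  proof -
    have *: "dec (l n) ! i \<in> prime_support f Q (g n)" using that by (auto simp: R_def)
    then have "0 < dec (l n) ! i" by (auto simp: prime_support_def prime_gt_0_nat)
    then show "t i n = dec (l n) ! i" by (simp add: t_def max_def)
    then show "t i n \<in> prime_support f Q (g n)" using * by simp
  qed
  have "inj_on y {..<k}"
  proof (rule inj_onI, rule ccontr)
    fix i j assume ij: "i \<in> {..<k}" "j \<in> {..<k}" "y i = y j" "i \<noteq> j"
    have "uae (tp X d) (\<lambda>n. t i n = t j n)" using ij(3) unfolding codes_eq[OF y y] .
    from uae_conjI[OF D this R[OF NP]] have "uae (tp X d) (\<lambda>n. False)"
    proof (rule uae_mono[OF D])
      fix n assume n: "t i n = t j n \<and> R Npos (l n) (g n)"
      then have "dec (l n) ! i = dec (l n) ! j" using ti(1) ij by (metis lessThan_iff)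
      then show False using n ij by (auto simp: R_def nth_eq_iff_index_eq)
    qed
    then show False using uae_False[OF D] by blast
  qed
  then have "card (y ` {..<k}) = k" by (simp add: card_image)
  moreover have "generator X q P \<and> (\<exists>c. codes q c f \<and> hdvd X (hpow X q c) x)" if "q \<in> y ` {..<k}" for q
  proof -
    obtain i where i: "i < k" "q = y i" using \<open>q \<in> _\<close> by blast
    have qh: "q \<in> hnat X" using codesD(2)[OF y] i by simp
    have cq: "codes d q (t i)" using y i by simp
    have "P = tp X q"
    proof (rule betaN_eqI[OF PB tp_betaN[OF qh]])
      fix \<Phi> assume "uae P \<Phi>"
      then have "{n \<in> Npos. \<Phi> n} \<in> P" by (simp add: uae_def)
      from R[OF this] show "uae (tp X q) \<Phi>" unfolding codes_uae[OF cq]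
      proof (rule uae_mono[OF D])
        fix n assume "R {n \<in> Npos. \<Phi> n} (l n) (g n)"
        from ti(2)[OF this i(1)] show "\<Phi> (t i n)" by (simp add: prime_support_def)
      qed
    qed
    moreover obtain c where c: "codes q c f" by (rule obtain_code[where g = f, OF qh f])
    moreover have "hdvd X (hpow X q c) x"
      unfolding hdvd_iff[OF codes_hpow[OF cq codes_comp[OF cq c]] d(2)]
      by (rule uae_mono[OF D R[OF NP]]) (use ti(2)[OF _ i(1)] in \<open>auto simp: prime_support_def\<close>)
    ultimately show ?thesis using qh by (auto simp: generator_def)
  qed
  ultimately show ?thesis by (intro exI[of _ "y ` {..<k}"]) simp
qed

end

text \<open>Primes outside \<open>Q\<close> are ignored: divisors of \<open>n\<close> with as large a support as \<open>n\<close> have the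
  same support, so the \<open>j\<close>-th smallest prime of the support is constant along divisibility.\<close>

lemma ex_immediate_predecessor_of_support:
  assumes F: "F \<in> betaN" and f: "\<And>q. 0 < q \<Longrightarrow> 0 < f q"
    and ge: "uae F (\<lambda>n. k \<le> card (prime_support f Q n))"
    and le: "\<not> uae F (\<lambda>n. Suc k \<le> card (prime_support f Q n))"
    and q: "uae F (\<lambda>n. \<exists>q\<in>Q. prime q \<and> multiplicity q n = Suc (f q))"
  shows "\<exists>C. immediate_predecessor C (tclass F)"
proof -
  let ?S = "prime_support f Q"
  define r where "r j n = sorted_list_of_set (?S n) ! j" for j n
  have fin: "finite (?S n)" if "0 < n" for n by (rule finite_prime_support[OF f that])
  have le': "uae F (\<lambda>n. \<not> Suc k \<le> card (?S n))" using le unfolding uae_not[OF F] .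
  \<comment> \<open>A prime of exponent \<open>Suc (f q)\<close> belongs to the support. Its
    position depends on \<open>n\<close> but takes only \<open>k\<close> values, so one position
    serves almost all \<open>n\<close>.\<close>
  have "uae F (\<lambda>n. \<exists>j<k. k \<le> card (?S n) \<and> \<not> Suc k \<le> card (?S n) \<and> multiplicity (r j n) n = Suc (f (r j n)))"
    using uae_conjI[OF F ge uae_conjI[OF F le' q]]
  proof (rule uae_mono[OF F])
    fix n :: nat assume n: "0 < n" "k \<le> card (?S n) \<and> \<not> Suc k \<le> card (?S n) \<and>
      (\<exists>q\<in>Q. prime q \<and> multiplicity q n = Suc (f q))"
    then obtain q where q: "q \<in> Q" "prime q" "multiplicity q n = Suc (f q)" by blast
    have "q ^ f q dvd n" by (rule multiplicity_dvd') (use q in simp)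
    then have "q \<in> set (sorted_list_of_set (?S n))"
      using q fin[OF n(1)] by (simp add: prime_support_def)
    then obtain j where "j < length (sorted_list_of_set (?S n))" "r j n = q"
      unfolding r_def in_set_conv_nth by blast
    moreover have "length (sorted_list_of_set (?S n)) = k" using n by simp
    ultimately show "\<exists>j<k. k \<le> card (?S n) \<and> \<not> Suc k \<le> card (?S n) \<and> multiplicity (r j n) n = Suc (f (r j n))"
      using q n by blast
  qed
  from uae_ex_less[OF F this] obtain j where j: "j < k"
    and large: "uae F (\<lambda>n. k \<le> card (?S n) \<and> \<not> Suc k \<le> card (?S n) \<and> multiplicity (r j n) n = Suc (f (r j n)))"
    by blast
  have card_mono: "card (?S m) \<le> card (?S n)" if "0 < n" "m dvd n" for m n
    by (rule card_mono[OF fin[OF that(1)] prime_support_mono[OF that(2)]])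
  have r: "r j n \<in> ?S n" if "0 < n" "k \<le> card (?S n)" for n
  proof -
    have "r j n \<in> set (sorted_list_of_set (?S n))"
      unfolding r_def by (rule nth_mem) (use that j in simp)
    then show ?thesis using fin[OF that(1)] by simp
  qed
  show ?thesis
  proof (rule ex_immediate_predecessor[where U = "\<lambda>n. k \<le> card (?S n)" and V = "\<lambda>n. Suc k \<le> card (?S n)"
        and r = "r j" and f = f, OF F])
    show "k \<le> card (?S n)" if "0 < n" "m dvd n" "k \<le> card (?S m)" for m n
      using card_mono[OF that(1,2)] that(3) by linarith
    show "Suc k \<le> card (?S n)" if "0 < n" "m dvd n" "Suc k \<le> card (?S m)" for m n
      using card_mono[OF that(1,2)] that(3) by linarith
    show "prime (r j n)" if "0 < n" "k \<le> card (?S n)" for n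
      using r[OF that] by (simp add: prime_support_def)
    show "r j m = r j n" if "0 < n" "m dvd n" "k \<le> card (?S m)" "\<not> Suc k \<le> card (?S n)" for m n
    proof -
      have "?S m = ?S n"
        by (rule card_seteq[OF fin[OF that(1)] prime_support_mono[OF that(2)]]) (use that in linarith)
      then show ?thesis by (simp add: r_def)
    qed
    show "k \<le> card (?S (n div r j n))"
      if n: "0 < n" "k \<le> card (?S n)" "multiplicity (r j n) n = Suc (f (r j n))" for n
    proof -
      define p where "p = r j n"
      have p: "prime p" using r[OF n(1,2)] by (simp add: prime_support_def p_def)
      have pn: "p ^ Suc (f p) dvd n" by (rule multiplicity_dvd') (use n(3) in \<open>simp add: p_def\<close>)
      then have "p dvd n" by (rule dvd_trans[rotated]) simp
      then obtain t where t: "n = p * t" by blast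
      have t': "n div p = t" using t p by (simp add: prime_gt_0_nat)
      have "0 < t" using n(1) t by (cases t) auto
      \<comment> \<open>Division by \<open>p\<close> lowers only the exponent of \<open>p\<close>,
        from at least \<open>Suc (f p)\<close> to at least \<open>f p\<close>, so no prime leaves
        the support.\<close>
      have "?S n \<subseteq> ?S t"
      proof
        fix s assume s: "s \<in> ?S n"
        then have sp: "s \<in> Q" "prime s" "s ^ f s dvd p * t" by (auto simp: prime_support_def t)
        have "s ^ f s dvd t"
        proof (cases "s = p")
          case True
          have "p * p ^ f p dvd p * t" using pn t by simp
          then show ?thesis using True p by (simp add: dvd_mult_cancel_left)
        next
          case False
          then have "coprime (s ^ f s) p" using p sp(2) by (simp add: primes_coprime)
          then show ?thesis using sp(3) by (simp add: coprime_dvd_mult_right_iff)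
        qed
        then show "s \<in> ?S t" using sp by (simp add: prime_support_def)
      qed
      then have "card (?S n) \<le> card (?S t)" by (rule Finite_Set.card_mono[OF fin[OF \<open>0 < t\<close>]])
      then show ?thesis using n(2) t' by (simp add: p_def)
    qed
  qed (rule large)
qed

theorem theorem5p9:
  fixes X :: "('v, 'w) nsext" and h :: enat and F :: "nat set set"
  assumes "20 \<le> h"
    and "nonstandard_extension h X"
    and "c_plus_saturated X"
    and "isomorphism_property X"
    and "F \<in> betaN"
    and "\<exists>P u. first_kind X P u
            \<and> uf_pattern X F (basic_class X (exp_succ X P u)) > 0
            \<and> esum (\<lambda>w. uf_pattern X F (basic_class X w)) {w \<in> exps X P. exp_le X P u w} < \<infinity>"
  shows "\<exists>C. immediate_predecessor C (tclass F)"
proof -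
  interpret saturated_extension X h
  proof
    have "(5::enat) \<le> 20" by simp
    then show "5 \<le> h" using assms(1) by (rule order_trans)
  qed (fact assms)+
  \<comment> \<open>The same choice as in \<open>uf_pattern\<close>, so that the hypotheses speak
    about the pattern of this \<open>x\<close>.\<close>
  define x where "x = (SOME x. generator X x F)"
  have "generator X x F" unfolding x_def by (rule someI_ex) (rule ex_generator[OF assms(5)])
  then have x: "x \<in> hnat X" "tp X x = F" by (auto simp: generator_def)
  obtain P u where Pu: "first_kind X P u" "pattern X x (basic_class X (exp_succ X P u)) > 0"
      "esum (\<lambda>w. pattern X x (basic_class X w)) {w \<in> exps X P. exp_le X P u w} < \<infinity>"
    using assms(6) unfolding uf_pattern_def x_def by blast
  have P: "P \<in> prime_ufs" "P \<in> betaN" and u: "u \<in> exps X P"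
    using Pu(1) unfolding first_kind_def prime_ufs_def by blast+
  obtain f where f': "\<forall>n>0. 0 < f n" "\<forall>p a. generator X p P \<longrightarrow> ((p, a) \<in> u \<longleftrightarrow> codes p a f)"
    using first_kind_function[OF Pu(1)] by blast
  have f: "\<And>n. 0 < n \<Longrightarrow> 0 < f n" "\<And>p a. generator X p P \<Longrightarrow> (p, a) \<in> u \<longleftrightarrow> codes p a f"
    using f' by blast+
  note succ = exp_succ_first_kind[OF P(2) u f]
  obtain p b where p: "generator X p P" "codes p b (\<lambda>n. Suc (f n))" "exact_dvd X p b x"
    by (rule pattern_exp_succ[OF P(1) succ Pu(2)])
  have "\<exists>N. \<forall>S. finite S \<longrightarrow>
      (\<forall>q\<in>S. generator X q P \<and> (\<exists>c. codes q c f \<and> hdvd X (hpow X q c) x)) \<longrightarrow> card S \<le> N"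
    by (rule card_bounded_of_esum[OF P(1) u _ x(1) Pu(3)]) (rule f(2))
  then obtain N where N: "\<forall>S. finite S \<longrightarrow>
      (\<forall>q\<in>S. generator X q P \<and> (\<exists>c. codes q c f \<and> hdvd X (hpow X q c) x)) \<longrightarrow> card S \<le> N"
    by (elim exE)
  have ex: "\<exists>k. \<exists>Q\<in>P. \<not> uae F (\<lambda>n. k \<le> card (prime_support f Q n))"
  proof (rule ccontr)
    assume "\<not> ?thesis"
    then have large: "uae (tp X x) (\<lambda>n. Suc N \<le> card (prime_support f Q n))" if "Q \<in> P" for Q
      using that unfolding x(2) by blast
    have "\<exists>S. finite S \<and> card S = Suc N \<and>
        (\<forall>q\<in>S. generator X q P \<and> (\<exists>c. codes q c f \<and> hdvd X (hpow X q c) x))"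
      by (rule ex_generators_of_large_support[OF P(1) x(1)]) (rule f(1) large, assumption)+
    then obtain S where S: "finite S" "card S = Suc N"
      "\<forall>q\<in>S. generator X q P \<and> (\<exists>c. codes q c f \<and> hdvd X (hpow X q c) x)" by (elim exE conjE)
    have "card S \<le> N" using N S(1,3) by (elim allE impE) assumption+
    then show False using S(2) by simp
  qed
  \<comment> \<open>The least size that the support for some \<open>Q\<close> in \<open>P\<close>
    fails to reach almost everywhere. It is not 0, and by minimality all sets in \<open>P\<close>
    reach its predecessor \<open>k'\<close>; so for this \<open>Q\<close> the size is exactly
    \<open>k'\<close> almost everywhere.\<close>
  define k where "k = (LEAST k. \<exists>Q\<in>P. \<not> uae F (\<lambda>n. k \<le> card (prime_support f Q n)))"
  obtain Q where Q: "Q \<in> P" "\<not> uae F (\<lambda>n. k \<le> card (prime_support f Q n))"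
    using LeastI_ex[OF ex] unfolding k_def by blast
  have "k \<noteq> 0" using Q(2) uae_True[OF assms(5)] by (cases k) simp_all
  then obtain k' where k': "k = Suc k'" by (cases k) auto
  have ge: "uae F (\<lambda>n. k' \<le> card (prime_support f Q n))"
    using not_less_Least[of k' "\<lambda>k. \<exists>Q\<in>P. \<not> uae F (\<lambda>n. k \<le> card (prime_support f Q n))"] Q(1) k'
    unfolding k_def[symmetric] by blast
  have le: "\<not> uae F (\<lambda>n. Suc k' \<le> card (prime_support f Q n))" using Q(2) unfolding k' .
  obtain x' where x': "x' \<in> hnat X" "x = hmult X (hpow X p b) x'" "\<not> hdvd X p x'"
    using p(3) unfolding exact_dvd_def by blast
  have ph: "p \<in> hnat X" "tp X p = P" using p(1) by (auto simp: generator_def)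
  obtain c g l where c: "codes c p g" "codes c x' l" using ex_common_code[OF ph(1) x'(1)] .
  note C = tp_betaN[OF codesD(1)[OF c(1)]]
  \<comment> \<open>This writes \<open>x\<close> as p^(f(p) + 1) x' over one code. As
    \<open>p\<close> does not divide x', the multiplicity of the coded prime is read off pointwise,
    and that prime lies in \<open>Q\<close> because \<open>p\<close> generates
    \<open>P\<close>.\<close>
  have cx: "codes c x (\<lambda>n. g n ^ Suc (f (g n)) * l n)"
    unfolding x'(2) by (rule codes_hmult[OF codes_hpow[OF c(1) codes_comp[OF c(1) p(2)]] c(2)])
  have QN: "Q \<subseteq> Npos" using Q(1) P(2) by (auto simp: betaN_def)
  have "uae P (\<lambda>q. q \<in> Q \<and> prime q)"
    by (rule uae_conjI[OF P(2) _ uae_prime[OF P(1)]]) (use uae_mem[OF P(2) QN] Q(1) in blast)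
  then have pr: "uae (tp X c) (\<lambda>n. g n \<in> Q \<and> prime (g n))" unfolding ph(2)[symmetric] codes_uae[OF c(1)] .
  have nd: "uae (tp X c) (\<lambda>n. \<not> g n dvd l n)" using x'(3) unfolding hdvd_iff[OF c] uae_not[OF C] .
  have mult: "uae F (\<lambda>n. \<exists>q\<in>Q. prime q \<and> multiplicity q n = Suc (f q))"
    unfolding x(2)[symmetric] codes_uae[OF cx] using uae_conjI[OF C pr nd]
  proof (rule uae_mono[OF C])
    fix n assume n: "(g n \<in> Q \<and> prime (g n)) \<and> \<not> g n dvd l n"
    have "multiplicity (g n) (g n ^ Suc (f (g n)) * l n) = Suc (f (g n))"
    proof (rule multiplicity_eqI)
      show "\<not> g n ^ Suc (Suc (f (g n))) dvd g n ^ Suc (f (g n)) * l n"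
      proof
        assume "g n ^ Suc (Suc (f (g n))) dvd g n ^ Suc (f (g n)) * l n"
        then have dvd: "g n ^ Suc (f (g n)) * g n dvd g n ^ Suc (f (g n)) * l n" by (simp only: power_Suc2)
        have ne: "g n ^ Suc (f (g n)) \<noteq> 0" using n by (auto simp: prime_gt_0_nat)
        have "g n dvd l n" using dvd unfolding dvd_times_left_cancel_iff[OF ne] .
        then show False using n by blast
      qed
    qed simp
    then show "\<exists>q\<in>Q. prime q \<and> multiplicity q (g n ^ Suc (f (g n)) * l n) = Suc (f q)" using n by blast
  qed
  show ?thesis by (rule ex_immediate_predecessor_of_support[OF assms(5) _ ge le mult]) (rule f(1))
qed

end
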